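(* Let $n\in\{1,2,3,4\}$ and $q\in\{0,1,2,\dots\}$. For any fixed time-independent potentials $V=V(\mathbf r)$ and $\mathbf A=\mathbf A(\mathbf r)$, the number of linearly independent time-independent linear differential operators $$Q=\sum_{j=0}^q b^{a_1,\dots,a_j}(\mathbf r)\,\frac{\partial}{\partial x_{a_1}}\cdots\frac{\partial}{\partial x_{a_j}}$$ of order not higher than $q$ which commute with $$H=\tfrac12\big((\mathbf p-e\mathbf A(\mathbf r))^2+V(\mathbf r)\big)$$ does not exceed $$\tilde N_q^n=\sum_{j=0}^q K_j^n,\qquad K_j^n=\frac{(j+n-1)!\,(j+n)!}{j!\,(j+1)!\,(n-1)!\,n!},$$ and $\tilde N_q^n$ is equal to the same number for $V=0$, $\mathbf A=0$, i.e. the number of linearly independent time-independent operators of this form of order not higher than $q$ which commute with $\tfrac12\mathbf p^2$.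
   Context: Here $\mathbf r=(x_1,\dots,x_n)$ with $x_a\in\mathbb R$, $p_a=-i\,\partial/\partial x_a$, $\mathbf p=(p_1,\dots,p_n)$, $e$ is a constant, $\mathbf A=(A_1,\dots,A_n)$ is an $n$-component function, and for an $n$-component operator $\mathbf u$ one writes $\mathbf u^2=\sum_{a=1}^n u_au_a$. The potentials and all coefficients of operators are smooth functions on $\mathbb R^n$; coefficients of operators may be complex-valued. The coefficients $b^{a_1,\dots,a_j}$ are symmetric in their indices, repeated indices are summed from $1$ to $n$, and the $j=0$ term is multiplication by a function. Equivalently, $Q$ can be written as $\sum_{j=0}^{q}[\cdots[F^{a_1,\dots,a_j}(\mathbf r),p_{a_1}]_+,\cdots,p_{a_j}]_+$ with symmetric $F^{a_1,\dots,a_j}$, where $[A,B]_+=AB+BA$. "$Q$ commutes with $H$" means $HQ-QH=0$ as operators. Linear independence is over $\mathbb C$, so the number of linearly independent operators is the dimension of the complex vector space of all such $Q$ (including $Q=0$). *)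

theory Defs
  imports "HOL-Analysis.Analysis" "HOL-Library.Function_Algebras"
begin

section \<open>Smooth functions and partial derivatives\<close>

definition partial :: "'n::finite \<Rightarrow> (real^'n \<Rightarrow> 'b::real_normed_vector) \<Rightarrow> real^'n \<Rightarrow> 'b" where
  "partial a f x = frechet_derivative f (at x) (axis a 1)"

text \<open>For \<open>as = [a\<^sub>1, \<dots>, a\<^sub>j]\<close> this is the iterated partial derivative with respect to
  \<open>x\<^sub>a\<^sub>1, \<dots>, x\<^sub>a\<^sub>j\<close>.\<close>

definition partials :: "'n::finite list \<Rightarrow> (real^'n \<Rightarrow> 'b::real_normed_vector) \<Rightarrow> real^'n \<Rightarrow> 'b" where
  "partials as f = foldr partial as f"

text \<open>Infinite differentiability. Since \<open>partial\<close> is only meaningful where the function is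
  differentiable, differentiability is demanded of every iterated partial derivative, including
  the function itself (\<open>as = []\<close>).\<close>

definition smooth :: "(real^'n::finite \<Rightarrow> 'b::real_normed_vector) \<Rightarrow> bool" where
  "smooth f \<longleftrightarrow> (\<forall>as x. partials as f differentiable (at x))"


section \<open>The Hamiltonian\<close>

type_synonym 'n operator = "(real^'n \<Rightarrow> complex) \<Rightarrow> (real^'n \<Rightarrow> complex)"

definition momentum :: "'n::finite \<Rightarrow> 'n operator" where
  "momentum a f x = - \<i> * partial a f x"

definition kinetic_momentum :: "real \<Rightarrow> (real^'n \<Rightarrow> real^'n) \<Rightarrow> 'n::finite \<Rightarrow> 'n operator" where
  "kinetic_momentum e A a f x = momentum a f x - of_real (e * A x $ a) * f x"

definition op_square :: "('n::finite \<Rightarrow> 'n operator) \<Rightarrow> 'n operator" where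
  "op_square u f x = (\<Sum>a\<in>UNIV. u a (u a f) x)"

definition hamiltonian ::
    "real \<Rightarrow> (real^'n \<Rightarrow> real^'n) \<Rightarrow> (real^'n \<Rightarrow> real) \<Rightarrow> 'n::finite operator" where
  "hamiltonian e A V f x =
     1 / 2 * (op_square (kinetic_momentum e A) f x + of_real (V x) * f x)"

lemma hamiltonian_free:
  "hamiltonian e (\<lambda>_. 0) (\<lambda>_. 0) =
     ((\<lambda>f x. 1 / 2 * op_square momentum f x) :: 'n::finite operator)"
proof -
  have "kinetic_momentum e (\<lambda>_. 0) = (momentum :: 'n \<Rightarrow> 'n operator)"
    by (intro ext) (simp add: kinetic_momentum_def)
  then show ?thesis
    by (intro ext) (simp add: hamiltonian_def)
qed


section \<open>Linear differential operators and their dimension\<close>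

text \<open>A coefficient \<open>b\<^bsup>a\<^sub>1,\<dots>,a\<^sub>j\<^esup>\<close> is given by \<open>b [a\<^sub>1, \<dots>, a\<^sub>j]\<close>.\<close>

definition symmetric_coeffs :: "('n list \<Rightarrow> 'c) \<Rightarrow> bool" where
  "symmetric_coeffs b \<longleftrightarrow> (\<forall>as bs. mset as = mset bs \<longrightarrow> b as = b bs)"

text \<open>Operators act on smooth functions. So that two operators are equal exactly when they agree
  on smooth functions, they are extended by zero to all other functions.\<close>

definition diff_op :: "nat \<Rightarrow> ('n list \<Rightarrow> real^'n \<Rightarrow> complex) \<Rightarrow> 'n::finite operator" where
  "diff_op q b f =
     (if smooth f
      then (\<lambda>x. \<Sum>j\<le>q. \<Sum>as | length as = j. b as x * partials as f x)
      else (\<lambda>_. 0))"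

definition diff_ops :: "nat \<Rightarrow> 'n::finite operator set" where
  "diff_ops q = {diff_op q b | b. symmetric_coeffs b \<and> (\<forall>as. smooth (b as))}"

text \<open>Operators that commute with \<open>H\<close>, the operator identity being tested on smooth functions.\<close>

definition symmetry_ops :: "nat \<Rightarrow> 'n::finite operator \<Rightarrow> 'n operator set" where
  "symmetry_ops q H = {Q \<in> diff_ops q. \<forall>f. smooth f \<longrightarrow> H (Q f) = Q (H f)}"

definition scale_op :: "complex \<Rightarrow> 'n operator \<Rightarrow> 'n operator" where
  "scale_op c Q = (\<lambda>f x. c * Q f x)"

interpretation op_space: vector_space "scale_op :: complex \<Rightarrow> 'n operator \<Rightarrow> 'n operator"
  by unfold_locales (simp_all add: scale_op_def fun_eq_iff algebra_simps)

text \<open>The library dimension of an infinite-dimensional space is \<open>0\<close>, so a bound on the dimension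
  has to be accompanied by this property.\<close>

definition finite_dim_ops :: "'n operator set \<Rightarrow> bool" where
  "finite_dim_ops S \<longleftrightarrow> (\<exists>B. finite B \<and> S \<subseteq> op_space.span B)"


section \<open>The bound\<close>

definition K_term :: "nat \<Rightarrow> nat \<Rightarrow> real" where
  "K_term n j = fact (j + n - 1) * fact (j + n) / (fact j * fact (j + 1) * fact (n - 1) * fact n)"

definition N_tilde :: "nat \<Rightarrow> nat \<Rightarrow> real" where
  "N_tilde n q = (\<Sum>j\<le>q. K_term n j)"

end

theory Submission
  imports Defs
begin

text \<open>Write an operator of order at most \<open>q\<close> as
  \<open>Q = \<Sum>\<^bsub>\<bar>\<beta>\<bar> \<le> q\<^esub> B\<^sub>\<beta> \<partial>\<^bsup>\<beta>\<^esup>\<close> with multi-indices \<open>\<beta>\<close>, which are represented by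
  multisets, and put \<open>k\<^sub>\<beta> = \<beta>! B\<^sub>\<beta>\<close>; for \<open>\<bar>\<beta>\<bar> = j\<close> these are, up to one common factor, the
  components of the symmetric tensor \<open>b\<^bsup>a\<^sub>1\<dots>a\<^sub>j\<^esup>\<close>.

  \<^bold>\<open>The upper bound.\<close> The Hamiltonian is \<open>-\<Delta>/2\<close> plus terms of lower order. The part of order
  \<open>q + 1\<close> of the commutator \<open>[H, Q]\<close> involves the Laplacian and the leading coefficients of \<open>Q\<close>
  only, and its vanishing is the Killing equation
  \<open>\<Sum>\<^sub>a \<gamma>\<^sub>a \<partial>\<^sub>a k\<^bsub>\<gamma> - e\<^sub>a\<^esub> = 0\<close> for \<open>\<bar>\<gamma>\<bar> = q + 1\<close> (\<open>killing_equation\<close>), whatever the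
  potentials are. If the leading coefficients vanish, then \<open>Q\<close> has order at most \<open>q - 1\<close>, so
  the dimension grows from \<open>q - 1\<close> to \<open>q\<close> by at most the dimension of the space of Killing
  tensors of rank \<open>q\<close>, and it remains to see that the latter is at most \<open>K\<^sub>q\<close>.

  Consider the jet \<open>c(\<alpha>, \<beta>) = \<partial>\<^bsup>\<alpha>\<^esup> k\<^sub>\<beta>\<close> of a Killing tensor at a point. It is the
  coefficient family of a formal function of \<open>x\<close> and \<open>p\<close>, homogeneous of degree \<open>q\<close> in \<open>p\<close>, that
  is annihilated by \<open>p\<cdot>\<partial>\<^sub>x\<close>. Together with \<open>x\<cdot>\<partial>\<^sub>p\<close> this operator generates a copy of
  sl(2), and \<open>\<bar>\<beta>\<bar> - \<bar>\<alpha>\<bar>\<close> is the weight. In negative weight \<open>p\<cdot>\<partial>\<^sub>x\<close> is injective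
  (\<open>negative_weight_eq_zero\<close>). Hence all derivatives of order \<open>q + 1\<close> of a Killing tensor
  vanish at every point, and the tensor is determined by its derivatives of order at most \<open>q\<close>
  at the origin. In positive weight \<open>(p\<cdot>\<partial>\<^sub>x)(x\<cdot>\<partial>\<^sub>p)\<close> is injective
  (\<open>p_dx_x_dp_inject\<close>). So \<open>p\<cdot>\<partial>\<^sub>x\<close> maps the jets with \<open>\<bar>\<alpha>\<bar> \<le> \<bar>\<beta>\<bar> = q\<close> onto those with
  \<open>\<bar>\<alpha>\<bar> < q\<close>, \<open>\<bar>\<beta>\<bar> = q + 1\<close>, and its kernel has dimension the difference of the two numbers
  of monomials, which is \<open>K\<^sub>q\<close> (\<open>dim_killing_jets_le\<close>).

  \<^bold>\<open>The free case.\<close> An operator with polynomial coefficients commutes with \<open>\<Delta>\<close> exactly if the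
  jet \<open>c\<close> of its coefficients satisfies
  \<open>\<Delta>\<^sub>x c + 2 p\<cdot>\<partial>\<^sub>x c = 0\<close>. On jets with \<open>\<bar>\<alpha>\<bar> \<le> \<bar>\<beta>\<bar> \<le> q\<close> this imposes one linear condition for
  every \<open>(\<alpha>, \<beta>)\<close> with \<open>\<bar>\<alpha>\<bar> + 2 \<le> \<bar>\<beta>\<bar> \<le> q + 1\<close>. Counting unknowns and conditions by the same
  binomial coefficients gives at least \<open>\<Sum>\<^sub>j K\<^sub>j\<close> independent solutions
  (\<open>N_tilde_le_dim_free_jets\<close>), and the upper bound turns this into an equality.\<close>

section \<open>Rank and nullity on subspaces\<close>

lemma (in vector_space) dim_mono_of_finite:
  assumes "V \<subseteq> W" and "W \<subseteq> span B" and "finite B"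
  shows "dim V \<le> dim W"
proof -
  obtain C where C: "C \<subseteq> W" "independent C" "W \<subseteq> span C" "card C = dim W"
    using basis_exists by blast
  then have "finite C"
    using assms independent_span_bound by (meson order_trans)
  then show ?thesis
    using dim_le_card[of V C] C assms(1) by auto
qed

text \<open>All ambient spaces here are infinite-dimensional, and the maps of interest are linear on a
  subspace only: derivatives are additive for differentiable functions but not in general.
  A basis of the kernel together with preimages of a basis of the image is a basis of \<open>S\<close>.\<close>

lemma (in vector_space_pair) rank_nullity_on:
  assumes S: "vs1.subspace S"
    and add: "\<And>x y. x \<in> S \<Longrightarrow> y \<in> S \<Longrightarrow> T (x + y) = T x + T y"
    and scale: "\<And>c x. x \<in> S \<Longrightarrow> T (s1 c x) = s2 c (T x)"
    and ker: "{x \<in> S. T x = 0} \<subseteq> vs1.span B1" "finite B1"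
    and img: "T ` S \<subseteq> vs2.span B2" "finite B2"
  shows "\<exists>B. finite B \<and> S \<subseteq> vs1.span B"
    and "vs1.dim S = vs1.dim {x \<in> S. T x = 0} + vs2.dim (T ` S)"
proof -
  obtain K where K: "K \<subseteq> {x \<in> S. T x = 0}" "vs1.independent K"
      "{x \<in> S. T x = 0} \<subseteq> vs1.span K" "card K = vs1.dim {x \<in> S. T x = 0}"
    using vs1.basis_exists by blast
  obtain C where C: "C \<subseteq> T ` S" "vs2.independent C" "T ` S \<subseteq> vs2.span C"
      "card C = vs2.dim (T ` S)"
    using vs2.basis_exists by blast
  have finK: "finite K" and finC: "finite C"
    using vs1.independent_span_bound[OF ker(2) K(2)] vs2.independent_span_bound[OF img(2) C(2)]
      K(1) C(1) ker(1) img(1) by blast+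
  have T0: "T 0 = 0"
    using scale[of 0 0] vs1.subspace_0[OF S] by simp
  have Tsum: "T (\<Sum>i\<in>I. s1 (r i) (h i)) = (\<Sum>i\<in>I. s2 (r i) (T (h i)))"
    if "finite I" "\<And>i. i \<in> I \<Longrightarrow> h i \<in> S" for I and r :: "'d \<Rightarrow> 'a" and h
    using that
  proof (induction I rule: finite_induct)
    case (insert x F)
    have "s1 (r x) (h x) \<in> S" "(\<Sum>i\<in>F. s1 (r i) (h i)) \<in> S"
      using insert.prems by (auto intro!: vs1.subspace_sum[OF S] vs1.subspace_scale[OF S])
    then show ?case
      using insert by (simp add: add scale)
  qed (simp add: T0)
  obtain g where g: "\<And>c. c \<in> C \<Longrightarrow> g c \<in> S \<and> T (g c) = c"
    using C(1) by (metis image_iff subsetD)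
  have inj: "inj_on g C"
    using g by (metis inj_onI)
  have "0 \<notin> C"
    using C(2) vs2.dependent_zero by blast
  then have disj: "K \<inter> g ` C = {}"
    using K(1) g by fastforce
  have K_S: "K \<subseteq> S" and C_S: "g ` C \<subseteq> S"
    using K(1) g by auto
  have indep: "vs1.independent (K \<union> g ` C)"
  proof
    assume "vs1.dependent (K \<union> g ` C)"
    then obtain u where u: "\<exists>v\<in>K \<union> g ` C. u v \<noteq> 0" "(\<Sum>v\<in>K \<union> g ` C. s1 (u v) v) = 0"
      using vs1.dependent_finite[of "K \<union> g ` C"] finK finC by auto
    have split: "(\<Sum>v\<in>K. s1 (u v) v) + (\<Sum>v\<in>g ` C. s1 (u v) v) = 0"
      using u(2) disj finK finC by (simp add: sum.union_disjoint)
    have "T ((\<Sum>v\<in>K. s1 (u v) v) + (\<Sum>v\<in>g ` C. s1 (u v) v))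
        = (\<Sum>v\<in>K. s2 (u v) (T v)) + (\<Sum>v\<in>g ` C. s2 (u v) (T v))"
    proof (subst add)
      show "(\<Sum>v\<in>K. s1 (u v) v) \<in> S" "(\<Sum>v\<in>g ` C. s1 (u v) v) \<in> S"
        using K_S C_S by (auto intro!: vs1.subspace_sum[OF S] vs1.subspace_scale[OF S])
      show "T (\<Sum>v\<in>K. s1 (u v) v) + T (\<Sum>v\<in>g ` C. s1 (u v) v)
          = (\<Sum>v\<in>K. s2 (u v) (T v)) + (\<Sum>v\<in>g ` C. s2 (u v) (T v))"
        using K_S C_S finK finC Tsum[of K id u] Tsum[of "g ` C" id u]
        by (simp add: subset_iff)
    qed
    moreover have "(\<Sum>v\<in>K. s2 (u v) (T v)) = 0"
      using K(1) by (intro sum.neutral) auto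
    ultimately have "(\<Sum>c\<in>C. s2 (u (g c)) c) = 0"
      using split T0 inj g by (simp add: sum.reindex)
    then have uC: "u (g c) = 0" if "c \<in> C" for c
      by (rule vs2.independentD[OF C(2) finC subset_refl, of "\<lambda>c. u (g c)"]) (use that in simp_all)
    then have "(\<Sum>v\<in>K. s1 (u v) v) = 0"
      using split inj by (simp add: sum.reindex)
    then have "u v = 0" if "v \<in> K" for v
      by (rule vs1.independentD[OF K(2) finK subset_refl, of u]) (use that in simp_all)
    then show False
      using u(1) uC by auto
  qed
  have span: "S \<subseteq> vs1.span (K \<union> g ` C)"
  proof
    fix x assume x: "x \<in> S"
    then have "T x \<in> vs2.span C"
      using C(3) by auto
    then obtain r where r: "T x = (\<Sum>c\<in>C. s2 (r c) c)"
      using vs2.span_finite[OF finC] by auto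
    define y where "y = (\<Sum>c\<in>C. s1 (r c) (g c))"
    have y: "y \<in> S" "T y = T x"
      unfolding y_def using g finC r
      by (auto simp: Tsum intro!: vs1.subspace_sum[OF S] vs1.subspace_scale[OF S])
    have "T (x - y) = 0"
      using add[of "x - y" y] x y vs1.subspace_diff[OF S] by simp
    then have "x - y \<in> vs1.span K"
      using K(3) x y vs1.subspace_diff[OF S] by blast
    then have "x - y \<in> vs1.span (K \<union> g ` C)"
      using vs1.span_mono[of K "K \<union> g ` C"] by auto
    moreover have "y \<in> vs1.span (K \<union> g ` C)"
      unfolding y_def by (intro vs1.span_sum vs1.span_scale vs1.span_base) auto
    ultimately show "x \<in> vs1.span (K \<union> g ` C)"
      using vs1.span_add[of "x - y" "K \<union> g ` C" y] by simp
  qed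
  then show "\<exists>B. finite B \<and> S \<subseteq> vs1.span B"
    using finK finC by (intro exI[of _ "K \<union> g ` C"] conjI) simp_all
  have "vs1.dim S = card (K \<union> g ` C)"
    using vs1.basis_card_eq_dim[of "K \<union> g ` C" S] K_S C_S span indep by simp
  also have "\<dots> = card K + card C"
    using disj finK finC inj by (simp add: card_Un_disjoint card_image)
  finally show "vs1.dim S = vs1.dim {x \<in> S. T x = 0} + vs2.dim (T ` S)"
    using K(4) C(4) by simp
qed

definition scale_coeff :: "complex \<Rightarrow> ('i \<Rightarrow> complex) \<Rightarrow> 'i \<Rightarrow> complex" where
  "scale_coeff r c = (\<lambda>i. r * c i)"

interpretation coeff_space: vector_space "scale_coeff :: complex \<Rightarrow> ('i \<Rightarrow> complex) \<Rightarrow> 'i \<Rightarrow> complex"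
  by unfold_locales (simp_all add: scale_coeff_def fun_eq_iff algebra_simps)

interpretation coeff_coeff: vector_space_pair
  "scale_coeff :: complex \<Rightarrow> ('i \<Rightarrow> complex) \<Rightarrow> 'i \<Rightarrow> complex"
  "scale_coeff :: complex \<Rightarrow> ('j \<Rightarrow> complex) \<Rightarrow> 'j \<Rightarrow> complex"
  by unfold_locales

interpretation op_coeff: vector_space_pair
  "scale_op :: complex \<Rightarrow> 'n operator \<Rightarrow> 'n operator"
  "scale_coeff :: complex \<Rightarrow> ('i \<Rightarrow> complex) \<Rightarrow> 'i \<Rightarrow> complex"
  by unfold_locales

interpretation coeff_op: vector_space_pair
  "scale_coeff :: complex \<Rightarrow> ('i \<Rightarrow> complex) \<Rightarrow> 'i \<Rightarrow> complex"
  "scale_op :: complex \<Rightarrow> 'n operator \<Rightarrow> 'n operator"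
  by unfold_locales

definition supported :: "'i set \<Rightarrow> ('i \<Rightarrow> complex) set" where
  "supported I = {c. \<forall>i. i \<notin> I \<longrightarrow> c i = 0}"

lemma subspace_supported: "coeff_space.subspace (supported I)"
  by (intro coeff_space.subspaceI) (auto simp: supported_def scale_coeff_def)

definition unit_coeff :: "'i \<Rightarrow> 'i \<Rightarrow> complex" where
  "unit_coeff i = (\<lambda>k. if k = i then 1 else 0)"

lemma sum_fun_apply: "(\<Sum>i\<in>I. f i) x = (\<Sum>i\<in>I. f i x)"
  by (induction I rule: infinite_finite_induct) auto

lemma
  assumes "finite I"
  shows supported_span: "supported I \<subseteq> coeff_space.span (unit_coeff ` I)"
    and dim_supported: "coeff_space.dim (supported I) = card I"
proof -
  have inj: "inj_on unit_coeff I"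
    by (auto simp: inj_on_def unit_coeff_def fun_eq_iff split: if_splits)
  have expand: "(\<Sum>i\<in>I. scale_coeff (r i) (unit_coeff i)) k = (if k \<in> I then r k else 0)" for r k
    using assms by (simp add: sum_fun_apply scale_coeff_def unit_coeff_def if_distrib cong: if_cong)
  show span: "supported I \<subseteq> coeff_space.span (unit_coeff ` I)"
  proof
    fix c assume "c \<in> supported I"
    then have "c = (\<Sum>i\<in>I. scale_coeff (c i) (unit_coeff i))"
      by (auto simp: fun_eq_iff expand supported_def)
    also have "\<dots> \<in> coeff_space.span (unit_coeff ` I)"
      by (intro coeff_space.span_sum coeff_space.span_scale coeff_space.span_base) auto
    finally show "c \<in> coeff_space.span (unit_coeff ` I)" .
  qed
  have "coeff_space.independent (unit_coeff ` I)"
  proof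
    assume "coeff_space.dependent (unit_coeff ` I)"
    then obtain u where u: "\<exists>v\<in>unit_coeff ` I. u v \<noteq> 0"
        "(\<Sum>v\<in>unit_coeff ` I. scale_coeff (u v) v) = 0"
      using coeff_space.dependent_finite[of "unit_coeff ` I"] assms by auto
    from u(2) have "(\<Sum>i\<in>I. scale_coeff (u (unit_coeff i)) (unit_coeff i)) k = 0" for k
      using inj by (simp add: sum.reindex)
    then have "u (unit_coeff k) = 0" if "k \<in> I" for k
      unfolding expand using that by presburger
    then show False
      using u(1) by blast
  qed
  moreover have "unit_coeff ` I \<subseteq> supported I"
    by (auto simp: supported_def unit_coeff_def split: if_splits)
  ultimately have "coeff_space.dim (supported I) = card (unit_coeff ` I)"
    using coeff_space.basis_card_eq_dim[OF _ span] by simp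
  then show "coeff_space.dim (supported I) = card I"
    using inj by (simp add: card_image)
qed

section \<open>The Lie algebra sl(2) acting on jets\<close>

text \<open>A family \<open>c\<close> indexed by pairs of multi-indices stands for the derivatives at the origin
  \<open>c(\<alpha>, \<beta>) = \<partial>\<^sub>x\<^bsup>\<alpha>\<^esup> \<partial>\<^sub>p\<^bsup>\<beta>\<^esup> F\<close> of a function \<open>F(x, p)\<close>. In these coordinates the next two
  definitions are the operators \<open>F \<mapsto> p\<cdot>\<partial>\<^sub>x F\<close> and \<open>F \<mapsto> x\<cdot>\<partial>\<^sub>p F\<close>. The truncated
  difference \<open>\<beta> - {#a#}\<close> is harmless because its coefficient \<open>count \<beta> a\<close> vanishes if \<open>a\<close> does
  not occur in \<open>\<beta>\<close>.\<close>

definition p_dx :: "('n::finite multiset \<times> 'n multiset \<Rightarrow> complex) \<Rightarrow> 'n multiset \<times> 'n multiset \<Rightarrow> complex" where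
  "p_dx c = (\<lambda>(\<alpha>, \<beta>). \<Sum>a\<in>UNIV. of_nat (count \<beta> a) * c (add_mset a \<alpha>, \<beta> - {#a#}))"

definition x_dp :: "('n::finite multiset \<times> 'n multiset \<Rightarrow> complex) \<Rightarrow> 'n multiset \<times> 'n multiset \<Rightarrow> complex" where
  "x_dp c = (\<lambda>(\<alpha>, \<beta>). \<Sum>a\<in>UNIV. of_nat (count \<alpha> a) * c (\<alpha> - {#a#}, add_mset a \<beta>))"

abbreviation weight :: "'n multiset \<times> 'n multiset \<Rightarrow> int" where
  "weight i \<equiv> int (size (snd i)) - int (size (fst i))"

lemma p_dx_add: "p_dx (c + d) = p_dx c + p_dx d"
  and p_dx_scale: "p_dx (scale_coeff r c) = scale_coeff r (p_dx c)"
  and x_dp_add: "x_dp (c + d) = x_dp c + x_dp d"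
  and x_dp_scale: "x_dp (scale_coeff r c) = scale_coeff r (x_dp c)"
  and p_dx_zero: "p_dx 0 = 0"
  and x_dp_zero: "x_dp 0 = 0"
  by (auto simp: fun_eq_iff p_dx_def x_dp_def scale_coeff_def sum.distrib algebra_simps
      sum_distrib_left)

lemma p_dx_funpow_zero: "(p_dx ^^ m) 0 = 0"
  by (induction m) (simp_all only: funpow.simps o_apply id_apply p_dx_zero)

lemma p_dx_swap: "p_dx (c \<circ> prod.swap) = x_dp c \<circ> prod.swap"
  and x_dp_swap: "x_dp (c \<circ> prod.swap) = p_dx c \<circ> prod.swap"
  by (auto simp: fun_eq_iff p_dx_def x_dp_def)

lemma size_eq_sum_count: "size \<beta> = (\<Sum>a\<in>UNIV. count \<beta> a)" for \<beta> :: "'n::finite multiset"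
  unfolding size_multiset_overloaded_eq
  by (intro sum.mono_neutral_left) (auto simp: not_in_iff)

text \<open>The commutator of \<open>p\<^sub>a \<partial>\<^bsub>x\<^sub>a\<^esub>\<close> and \<open>x\<^sub>b \<partial>\<^bsub>p\<^sub>b\<^esub>\<close> is zero for \<open>a \<noteq> b\<close> and
  \<open>p\<^sub>a \<partial>\<^bsub>p\<^sub>a\<^esub> - x\<^sub>a \<partial>\<^bsub>x\<^sub>a\<^esub>\<close> for \<open>a = b\<close>. The sum over \<open>a\<close> is the difference of the two
  Euler operators, which acts on a jet coefficient as its weight.\<close>

lemma p_dx_x_dp_commutator:
  "p_dx (x_dp c) i = x_dp (p_dx c) i + of_int (weight i) * c i"
proof -
  obtain \<alpha> \<beta> where i: "i = (\<alpha>, \<beta>)"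
    by fastforce
  have term_eq:
    "of_nat (count \<beta> a) * (of_nat (count (add_mset a \<alpha>) b)
        * c (add_mset a \<alpha> - {#b#}, add_mset b (\<beta> - {#a#})))
     = of_nat (count \<alpha> b) * (of_nat (count (add_mset b \<beta>) a)
        * c (add_mset a (\<alpha> - {#b#}), add_mset b \<beta> - {#a#}))
       + (if a = b then (of_nat (count \<beta> a) - of_nat (count \<alpha> a)) * c (\<alpha>, \<beta>) else 0)" for a b
  proof (cases "a = b")
    case True
    then show ?thesis
      by (cases "a \<in># \<alpha>"; cases "a \<in># \<beta>"; simp add: not_in_iff; simp add: algebra_simps)
  next
    case False
    then have "add_mset a \<alpha> - {#b#} = add_mset a (\<alpha> - {#b#})"
      "add_mset b (\<beta> - {#a#}) = add_mset b \<beta> - {#a#}"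
      by (auto simp: multiset_eq_iff)
    then show ?thesis
      using False by (simp only: count_add_mset if_False) (simp add: mult.left_commute)
  qed
  have "p_dx (x_dp c) i - x_dp (p_dx c) i
      = (\<Sum>a\<in>UNIV. \<Sum>b\<in>UNIV. of_nat (count \<beta> a) * (of_nat (count (add_mset a \<alpha>) b)
          * c (add_mset a \<alpha> - {#b#}, add_mset b (\<beta> - {#a#}))))
        - (\<Sum>a\<in>UNIV. \<Sum>b\<in>UNIV. of_nat (count \<alpha> b) * (of_nat (count (add_mset b \<beta>) a)
          * c (add_mset a (\<alpha> - {#b#}), add_mset b \<beta> - {#a#})))"
    unfolding i p_dx_def x_dp_def prod.case sum_distrib_left
    by (subst (4) sum.swap) (rule refl)
  also have "\<dots> = (\<Sum>a\<in>UNIV. (of_nat (count \<beta> a) - of_nat (count \<alpha> a)) * c (\<alpha>, \<beta>))"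
    unfolding sum_subtractf[symmetric] term_eq by simp
  also have "\<dots> = of_int (weight i) * c i"
    by (simp add: i size_eq_sum_count sum_subtractf flip: sum_distrib_right)
  finally show ?thesis
    by (simp add: algebra_simps)
qed

lemma p_dx_nonzeroE:
  assumes "p_dx c (\<alpha>, \<beta>) \<noteq> 0"
  obtains a where "a \<in># \<beta>" and "c (add_mset a \<alpha>, \<beta> - {#a#}) \<noteq> 0"
proof -
  from assms have "(\<Sum>a\<in>UNIV. of_nat (count \<beta> a) * c (add_mset a \<alpha>, \<beta> - {#a#})) \<noteq> 0"
    by (simp add: p_dx_def)
  then obtain a where "of_nat (count \<beta> a) * c (add_mset a \<alpha>, \<beta> - {#a#}) \<noteq> 0"
    by (auto elim: sum.not_neutral_contains_not_neutral)
  then show ?thesis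
    using that by (auto simp flip: count_greater_zero_iff)
qed

lemma p_dx_weight:
  assumes "\<And>i. c i \<noteq> 0 \<Longrightarrow> weight i = \<mu>" and "p_dx c i \<noteq> 0"
  shows "weight i = \<mu> + 2"
proof -
  obtain \<alpha> \<beta> where i: "i = (\<alpha>, \<beta>)"
    by fastforce
  then obtain a where a: "a \<in># \<beta>" "c (add_mset a \<alpha>, \<beta> - {#a#}) \<noteq> 0"
    using assms(2) p_dx_nonzeroE by blast
  moreover obtain \<beta>' where "\<beta> = add_mset a \<beta>'"
    using multi_member_split[OF a(1)] by blast
  ultimately show ?thesis
    using assms(1)[OF a(2)] by (simp add: i)
qed

lemma p_dx_funpow_weight:
  assumes "\<And>i. c i \<noteq> 0 \<Longrightarrow> weight i = \<mu>"
  shows "(p_dx ^^ m) c i \<noteq> 0 \<Longrightarrow> weight i = \<mu> + 2 * int m"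
proof (induction m arbitrary: i)
  case (Suc m)
  then show ?case
    using p_dx_weight[of "(p_dx ^^ m) c" "\<mu> + 2 * int m" i] by auto
qed (use assms in auto)

text \<open>Moving \<open>x\<cdot>\<partial>\<^sub>p\<close> to the left through \<open>m + 1\<close> factors \<open>p\<cdot>\<partial>\<^sub>x\<close> collects the weights
  \<open>\<mu>, \<mu> + 2, \<dots>, \<mu> + 2 m\<close>, whose sum is \<open>(m + 1)(\<mu> + m)\<close>.\<close>

lemma p_dx_funpow_x_dp:
  assumes "\<And>i. c i \<noteq> 0 \<Longrightarrow> weight i = \<mu>"
  shows "(p_dx ^^ Suc m) (x_dp c)
    = x_dp ((p_dx ^^ Suc m) c) + scale_coeff (of_int ((int m + 1) * (\<mu> + int m))) ((p_dx ^^ m) c)"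
proof (induction m)
  case 0
  have "of_int (weight i) * c i = of_int \<mu> * c i" for i
    using assms by (cases "c i = 0") auto
  then show ?case
    by (auto simp: fun_eq_iff p_dx_x_dp_commutator scale_coeff_def)
next
  case (Suc m)
  let ?d = "(p_dx ^^ Suc m) c"
  have "of_int (weight i) * ?d i = of_int (\<mu> + 2 * (int m + 1)) * ?d i" for i
    using p_dx_funpow_weight[of c \<mu> "Suc m" i] assms by (cases "?d i = 0") auto
  then have "p_dx (x_dp ?d) = x_dp (p_dx ?d) + scale_coeff (of_int (\<mu> + 2 * (int m + 1))) ?d"
    by (auto simp: fun_eq_iff p_dx_x_dp_commutator scale_coeff_def)
  moreover have "(p_dx ^^ Suc (Suc m)) (x_dp c) = p_dx ((p_dx ^^ Suc m) (x_dp c))"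
    by simp
  ultimately have "(p_dx ^^ Suc (Suc m)) (x_dp c)
      = x_dp (p_dx ?d) + (scale_coeff (of_int (\<mu> + 2 * (int m + 1))) ?d
        + scale_coeff (of_int ((int m + 1) * (\<mu> + int m))) ?d)"
    unfolding Suc.IH p_dx_add p_dx_scale by (simp add: add.assoc)
  also have "scale_coeff (of_int (\<mu> + 2 * (int m + 1))) ?d
        + scale_coeff (of_int ((int m + 1) * (\<mu> + int m))) ?d
      = scale_coeff (of_int ((int (Suc m) + 1) * (\<mu> + int (Suc m)))) ?d"
    by (simp add: scale_coeff_def fun_eq_iff algebra_simps)
  finally show ?case
    by simp
qed

lemma p_dx_funpow_eq_zero:
  assumes "\<And>i. c i \<noteq> 0 \<Longrightarrow> size (fst i) \<le> k"
  shows "(p_dx ^^ Suc k) c = 0"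
proof -
  have "(p_dx ^^ m) c i \<noteq> 0 \<Longrightarrow> size (fst i) + m \<le> k" for m i
  proof (induction m arbitrary: i)
    case (Suc m)
    obtain \<alpha> \<beta> where i: "i = (\<alpha>, \<beta>)"
      by fastforce
    then obtain a where "(p_dx ^^ m) c (add_mset a \<alpha>, \<beta> - {#a#}) \<noteq> 0"
      using Suc.prems by (auto elim: p_dx_nonzeroE)
    then show ?case
      using Suc.IH[of "(add_mset a \<alpha>, \<beta> - {#a#})"] by (auto simp: i)
  qed (use assms in auto)
  from this[of "Suc k"] show ?thesis
    by (fastforce simp: fun_eq_iff)
qed

lemma scale_coeff_eq_zeroD: "scale_coeff r c = 0 \<Longrightarrow> r \<noteq> 0 \<Longrightarrow> c = 0"
  using coeff_space.scale_eq_0_iff by blast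

text \<open>Write \<open>E = p\<cdot>\<partial>\<^sub>x\<close>. If \<open>E\<^bsup>m+1\<^esup> c = 0\<close>, then the commutation formula leaves
  \<open>(m + 1)(\<mu> + m) E\<^bsup>m\<^esup> c = 0\<close>, and the factor is nonzero for \<open>\<mu> \<ge> 1\<close>. Since \<open>E\<close> lowers the degree
  in \<open>x\<close>, some power of it kills \<open>c\<close>, and the exponent can be lowered to \<open>0\<close>.\<close>

lemma eq_zero_if_p_dx_x_dp_eq_zero:
  assumes weight: "\<And>i. c i \<noteq> 0 \<Longrightarrow> weight i = \<mu>" and "\<mu> \<ge> 1"
    and bound: "\<And>i. c i \<noteq> 0 \<Longrightarrow> size (fst i) \<le> k"
    and zero: "p_dx (x_dp c) = 0"
  shows "c = 0"
proof -
  have step: "(p_dx ^^ m) c = 0" if m: "(p_dx ^^ Suc m) c = 0" for m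
  proof -
    have funpow: "(p_dx ^^ Suc m) (x_dp c)
        = x_dp ((p_dx ^^ Suc m) c) + scale_coeff (of_int ((int m + 1) * (\<mu> + int m))) ((p_dx ^^ m) c)"
      using weight by (rule p_dx_funpow_x_dp)
    have "(p_dx ^^ Suc m) (x_dp c) = (p_dx ^^ m) (p_dx (x_dp c))"
      by (simp only: funpow_Suc_right o_apply)
    then have "(p_dx ^^ Suc m) (x_dp c) = 0"
      by (simp only: zero p_dx_funpow_zero)
    then have "scale_coeff (of_int ((int m + 1) * (\<mu> + int m))) ((p_dx ^^ m) c) = 0"
      unfolding funpow m by (simp only: x_dp_zero add_0)
    moreover have "(int m + 1) * (\<mu> + int m) \<noteq> 0"
      using \<open>\<mu> \<ge> 1\<close> by auto
    ultimately show ?thesis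
      using scale_coeff_eq_zeroD by (metis of_int_eq_0_iff)
  qed
  have "(p_dx ^^ m) c = 0 \<Longrightarrow> c = 0" for m
  proof (induction m)
    case (Suc m)
    then show ?case
      using step by blast
  qed simp
  then show ?thesis
    using p_dx_funpow_eq_zero[OF bound] by blast
qed

text \<open>Exchanging \<open>x\<close> and \<open>p\<close> reverses the sign of the weight and interchanges the two operators,
  so this is a case of the preceding lemma.\<close>

lemma eq_zero_if_p_dx_eq_zero:
  assumes weight: "\<And>i. c i \<noteq> 0 \<Longrightarrow> weight i = \<mu>" and "\<mu> < 0"
    and bound: "\<And>i. c i \<noteq> 0 \<Longrightarrow> size (snd i) \<le> k"
    and zero: "p_dx c = 0"
  shows "c = 0"
proof -
  have "x_dp (c \<circ> prod.swap) = 0"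
    by (simp add: x_dp_swap zero fun_eq_iff)
  then have "p_dx (x_dp (c \<circ> prod.swap)) = 0"
    by (simp add: p_dx_zero)
  moreover have "weight i = - \<mu>" "size (fst i) \<le> k" if "(c \<circ> prod.swap) i \<noteq> 0" for i
    using weight[of "prod.swap i"] bound[of "prod.swap i"] that by auto
  ultimately have "c \<circ> prod.swap = 0"
    using eq_zero_if_p_dx_x_dp_eq_zero[of "c \<circ> prod.swap" "- \<mu>" k] \<open>\<mu> < 0\<close> by auto
  then show ?thesis
    by (metis comp_apply swap_swap zero_fun_apply ext)
qed

text \<open>The two operators shift the weight by \<open>2\<close> and \<open>-2\<close>, so that an equation between jets splits into
  equations for the parts of a fixed weight.\<close>

definition weight_part :: "int \<Rightarrow> ('n multiset \<times> 'n multiset \<Rightarrow> complex) \<Rightarrow> 'n multiset \<times> 'n multiset \<Rightarrow> complex" where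
  "weight_part \<mu> c = (\<lambda>i. if weight i = \<mu> then c i else 0)"

lemma p_dx_weight_part: "p_dx (weight_part \<mu> c) = weight_part (\<mu> + 2) (p_dx c)"
proof (intro ext)
  fix i :: "'a multiset \<times> 'a multiset"
  obtain \<alpha> \<beta> where i: "i = (\<alpha>, \<beta>)"
    by fastforce
  have "of_nat (count \<beta> a) * weight_part \<mu> c (add_mset a \<alpha>, \<beta> - {#a#})
      = (if weight i = \<mu> + 2 then of_nat (count \<beta> a) * c (add_mset a \<alpha>, \<beta> - {#a#}) else 0)" for a
    by (cases "a \<in># \<beta>") (auto simp: i weight_part_def not_in_iff dest: multi_member_split)
  then show "p_dx (weight_part \<mu> c) i = weight_part (\<mu> + 2) (p_dx c) i"
    by (simp add: p_dx_def i weight_part_def)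
qed

lemma x_dp_weight_part: "x_dp (weight_part \<mu> c) = weight_part (\<mu> - 2) (x_dp c)"
proof -
  have swap: "weight_part \<nu> d \<circ> prod.swap = weight_part (- \<nu>) (d \<circ> prod.swap)" for \<nu> d
    by (auto simp: weight_part_def fun_eq_iff)
  have "x_dp (weight_part \<mu> c) \<circ> prod.swap = weight_part (\<mu> - 2) (x_dp c) \<circ> prod.swap"
    by (simp add: swap p_dx_weight_part flip: p_dx_swap)
  then show ?thesis
    by (metis comp_assoc comp_id swap_comp_swap)
qed

lemma p_dx_x_dp_inject:
  assumes pos: "\<And>i. c i \<noteq> 0 \<Longrightarrow> weight i \<ge> 1"
    and bound: "\<And>i. c i \<noteq> 0 \<Longrightarrow> size (fst i) \<le> k"
    and zero: "p_dx (x_dp c) = 0"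
  shows "c = 0"
proof
  fix i
  show "c i = 0 i"
  proof (rule ccontr)
    assume "\<not> ?thesis"
    then have "c i \<noteq> 0"
      by simp
    let ?d = "weight_part (weight i) c"
    have "p_dx (x_dp ?d) = 0"
      using zero by (simp add: x_dp_weight_part p_dx_weight_part) (simp add: weight_part_def fun_eq_iff)
    moreover have "weight i' = weight i" "size (fst i') \<le> k" if "?d i' \<noteq> 0" for i'
      using that bound[of i'] by (auto simp: weight_part_def split: if_splits)
    ultimately have "?d = 0"
      using eq_zero_if_p_dx_x_dp_eq_zero[of ?d "weight i" k] pos[OF \<open>c i \<noteq> 0\<close>] by blast
    then have "?d i = 0"
      by simp
    then show False
      using \<open>c i \<noteq> 0\<close> by (simp add: weight_part_def)
  qed
qed

text \<open>For a Killing tensor of rank \<open>k\<close> this says that the derivatives of order greater than \<open>k\<close> are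
  zero; it is the reason why Killing tensors of flat space are polynomials.\<close>

lemma negative_weight_eq_zero:
  assumes zero: "p_dx c = 0"
    and bound: "\<And>i. c i \<noteq> 0 \<Longrightarrow> size (snd i) \<le> k"
    and neg: "weight i < 0"
  shows "c i = 0"
proof -
  let ?d = "weight_part (weight i) c"
  have "p_dx ?d = 0"
    using zero by (simp add: p_dx_weight_part) (simp add: weight_part_def fun_eq_iff)
  moreover have "weight i' = weight i" "size (snd i') \<le> k" if "?d i' \<noteq> 0" for i'
    using that bound[of i'] by (auto simp: weight_part_def split: if_splits)
  ultimately have "?d = 0"
    using eq_zero_if_p_dx_eq_zero[of ?d "weight i" k] neg by blast
  then have "?d i = 0"
    by simp
  then show ?thesis
    by (simp add: weight_part_def)
qed

section \<open>Counting jets\<close>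

lemma finite_multisets_size: "finite {\<alpha> :: 'n::finite multiset. size \<alpha> = k}"
  and card_multisets_size:
    "card {\<alpha> :: 'n::finite multiset. size \<alpha> = k} = (CARD('n) + k - 1) choose k"
  using finite_multisets_of_size[of "UNIV :: 'n set" k] card_multisets_of_size[of "UNIV :: 'n set" k]
  by (simp_all add: multisets_of_size_def)

lemma finite_multisets_size_le: "finite {\<alpha> :: 'n::finite multiset. size \<alpha> \<le> k}"
  and card_multisets_size_le:
    "card {\<alpha> :: 'n::finite multiset. size \<alpha> \<le> k} = (CARD('n) + k) choose k"
proof -
  have eq: "{\<alpha> :: 'n multiset. size \<alpha> \<le> k} = (\<Union>i\<le>k. {\<alpha>. size \<alpha> = i})"
    by auto
  then show "finite {\<alpha> :: 'n multiset. size \<alpha> \<le> k}"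
    by (auto intro: finite_multisets_size)
  have "card {\<alpha> :: 'n multiset. size \<alpha> \<le> k} = (\<Sum>i\<le>k. card {\<alpha> :: 'n multiset. size \<alpha> = i})"
    unfolding eq by (intro card_UN_disjoint) (auto intro: finite_multisets_size)
  also have "\<dots> = (\<Sum>i\<le>k. (CARD('n) - 1 + i) choose i)"
    by (simp add: card_multisets_size Suc_leI add.commute)
  also have "\<dots> = Suc (CARD('n) - 1 + k) choose k"
    by (rule sum_choose_lower)
  also have "\<dots> = (CARD('n) + k) choose k"
    by simp
  finally show "card {\<alpha> :: 'n multiset. size \<alpha> \<le> k} = (CARD('n) + k) choose k" .
qed

text \<open>The jet of a Killing tensor of rank \<open>j\<close> lives on the first of the following index sets; the
  Killing equation and its derivatives, as far as they are not trivial there, are indexed by the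
  second.\<close>

definition killing_jets :: "nat \<Rightarrow> ('n::finite multiset \<times> 'n multiset) set" where
  "killing_jets j = {\<alpha>. size \<alpha> \<le> j} \<times> {\<beta>. size \<beta> = j}"

definition killing_eqs :: "nat \<Rightarrow> ('n::finite multiset \<times> 'n multiset) set" where
  "killing_eqs j = {\<alpha>. size \<alpha> < j} \<times> {\<beta>. size \<beta> = Suc j}"

lemma finite_multisets_size_less: "finite {\<alpha> :: 'n::finite multiset. size \<alpha> < k}"
  by (rule finite_subset[OF _ finite_multisets_size_le[of k]]) auto

lemma finite_killing_jets: "finite (killing_jets j)"
  and finite_killing_eqs: "finite (killing_eqs j)"
  by (simp_all add: killing_jets_def killing_eqs_def finite_multisets_size finite_multisets_size_le
      finite_multisets_size_less)

text \<open>The first term is \<open>(j + 1) K\<^sub>j\<close> and the second is \<open>j K\<^sub>j\<close>. The case distinction stands for the binomial coefficient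
  \<open>n + j - 1\<close> over \<open>j - 1\<close>, which is \<open>0\<close> for \<open>j = 0\<close>.\<close>

lemma K_term_binomial:
  assumes "n \<ge> 1"
  shows "real ((n + j) choose j) * real ((n + j - 1) choose j)
    - (case j of 0 \<Rightarrow> 0 | Suc i \<Rightarrow> real ((n + i) choose i)) * real ((n + j) choose Suc j)
    = K_term n j"
proof -
  obtain m where n: "n = Suc m"
    using assms by (cases n) auto
  show ?thesis
  proof (cases j)
    case 0
    then show ?thesis
      by (simp add: K_term_def n)
  next
    case (Suc i)
    have f: "fact (Suc (Suc i)) = (real i + 2) * (real i + 1) * fact i"
      "fact (Suc i) = (real i + 1) * fact i" "fact (Suc m) = (real m + 1) * fact m"
      by (simp_all add: algebra_simps)
    have b: "real (Suc (Suc (m + i)) choose Suc i) = fact (Suc (Suc (m + i))) / (fact (Suc i) * fact (Suc m))"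
      "real (Suc (m + i) choose Suc i) = fact (Suc (m + i)) / (fact (Suc i) * fact m)"
      "real (Suc (m + i) choose i) = fact (Suc (m + i)) / (fact i * fact (Suc m))"
      "real (Suc (Suc (m + i)) choose Suc (Suc i)) = fact (Suc (Suc (m + i))) / (fact (Suc (Suc i)) * fact m)"
      by (simp_all add: binomial_fact del: fact_Suc binomial_Suc_Suc)
    have pos: "(fact i :: real) \<noteq> 0" "(fact m :: real) \<noteq> 0" "real i + 1 \<noteq> 0" "real i + 2 \<noteq> 0"
      "real m + 1 \<noteq> 0"
      by auto
    define u :: real where "u = fact (Suc (m + i))"
    define v :: real where "v = fact (Suc (Suc (m + i)))"
    have "K_term n j = u * v / (fact (Suc i) * fact (Suc (Suc i)) * fact m * fact (Suc m))"
      by (simp add: K_term_def n Suc u_def v_def add.commute del: fact_Suc)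
    moreover have "v / (fact (Suc i) * fact (Suc m)) * (u / (fact (Suc i) * fact m))
        - u / (fact i * fact (Suc m)) * (v / (fact (Suc (Suc i)) * fact m))
      = u * v / (fact (Suc i) * fact (Suc (Suc i)) * fact m * fact (Suc m))"
      unfolding f using pos by (simp add: divide_simps) (simp add: algebra_simps)
    ultimately show ?thesis
      using b by (simp add: n Suc u_def v_def add.commute del: fact_Suc binomial_Suc_Suc)
  qed
qed

lemma card_killing_jets_diff:
  "real (card (killing_jets j :: ('n::finite multiset \<times> 'n multiset) set))
    - real (card (killing_eqs j :: ('n multiset \<times> 'n multiset) set)) = K_term CARD('n) j"
proof -
  have less: "card {\<alpha> :: 'n multiset. size \<alpha> < j} = (case j of 0 \<Rightarrow> 0 | Suc i \<Rightarrow> (CARD('n) + i) choose i)"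
    by (cases j) (simp_all add: less_Suc_eq_le card_multisets_size_le)
  show ?thesis
    unfolding killing_jets_def killing_eqs_def card_cartesian_product
      card_multisets_size_le card_multisets_size less
    by (subst K_term_binomial[symmetric]) (auto simp: Suc_leI split: nat.splits)
qed

lemma p_dx_supported:
  assumes "c \<in> supported (killing_jets j)"
  shows "p_dx c \<in> supported (killing_eqs j)"
proof -
  have "p_dx c (\<alpha>, \<beta>) = 0" if "(\<alpha>, \<beta>) \<notin> killing_eqs j" for \<alpha> \<beta>
  proof (rule ccontr)
    assume "p_dx c (\<alpha>, \<beta>) \<noteq> 0"
    then obtain a where a: "a \<in># \<beta>" "c (add_mset a \<alpha>, \<beta> - {#a#}) \<noteq> 0"
      by (rule p_dx_nonzeroE)
    then have "(add_mset a \<alpha>, \<beta> - {#a#}) \<in> killing_jets j"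
      using assms by (auto simp: supported_def)
    with a(1) that show False
      by (auto simp: killing_jets_def killing_eqs_def dest!: multi_member_split)
  qed
  then show ?thesis
    by (auto simp: supported_def)
qed

lemma x_dp_supported:
  assumes "c \<in> supported (killing_eqs j)"
  shows "x_dp c \<in> supported (killing_jets j)"
proof -
  have "x_dp c (\<alpha>, \<beta>) = 0" if "(\<alpha>, \<beta>) \<notin> killing_jets j" for \<alpha> \<beta>
  proof (rule ccontr)
    assume "x_dp c (\<alpha>, \<beta>) \<noteq> 0"
    then have "p_dx (c \<circ> prod.swap) (\<beta>, \<alpha>) \<noteq> 0"
      by (simp add: p_dx_swap)
    then obtain a where a: "a \<in># \<alpha>" "c (\<alpha> - {#a#}, add_mset a \<beta>) \<noteq> 0"
      by (rule p_dx_nonzeroE) simp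
    then have "(\<alpha> - {#a#}, add_mset a \<beta>) \<in> killing_eqs j"
      using assms by (auto simp: supported_def)
    with a(1) that show False
      by (auto simp: killing_jets_def killing_eqs_def dest!: multi_member_split)
  qed
  then show ?thesis
    by (auto simp: supported_def)
qed

lemma supported_in_span:
  "finite I \<Longrightarrow> c \<in> supported I \<Longrightarrow> c \<in> coeff_space.span (unit_coeff ` I)"
  using supported_span by blast

lemma dim_supported_rank_nullity:
  assumes "finite I" and "finite J" and "T ` supported I \<subseteq> supported J"
    and "\<And>c d. T (c + d) = T c + T d" and "\<And>r c. T (scale_coeff r c) = scale_coeff r (T c)"
  shows "card I = coeff_space.dim {c \<in> supported I. T c = 0} + coeff_space.dim (T ` supported I)"
proof -
  have "coeff_space.dim (supported I)
      = coeff_space.dim {c \<in> supported I. T c = 0} + coeff_space.dim (T ` supported I)"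
    using assms
    by (intro coeff_coeff.rank_nullity_on(2)[where ?B1.0 = "unit_coeff ` I" and ?B2.0 = "unit_coeff ` J"])
      (auto simp: subspace_supported intro!: supported_in_span)
  then show ?thesis
    using dim_supported[OF assms(1)] by simp
qed

text \<open>The composition of \<open>x_dp\<close> and \<open>p_dx\<close> is injective on the jets supported in \<open>killing_eqs j\<close>,
  where the weights are at least \<open>2\<close>. It factors through the jets supported in \<open>killing_jets j\<close>, so
  the rank of \<open>p_dx\<close> on those is at least the number of elements of \<open>killing_eqs j\<close>.\<close>

lemma dim_killing_jets_le:
  "real (coeff_space.dim {c \<in> supported (killing_jets j :: ('n::finite multiset \<times> 'n multiset) set).
      p_dx c = 0}) \<le> K_term CARD('n) j"
proof -
  let ?I = "killing_jets j :: ('n multiset \<times> 'n multiset) set"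
  let ?J = "killing_eqs j :: ('n multiset \<times> 'n multiset) set"
  have rank_I: "card ?I = coeff_space.dim {c \<in> supported ?I. p_dx c = 0}
      + coeff_space.dim (p_dx ` supported ?I)"
    by (rule dim_supported_rank_nullity[OF finite_killing_jets finite_killing_eqs[of j]])
      (auto simp: p_dx_supported p_dx_add p_dx_scale)
  have "c = 0" if "c \<in> supported ?J" "p_dx (x_dp c) = 0" for c
  proof (rule p_dx_x_dp_inject[OF _ _ that(2)])
    fix i assume "c i \<noteq> 0"
    then have "i \<in> ?J"
      using that(1) unfolding supported_def by blast
    then show "weight i \<ge> 1" "size (fst i) \<le> j"
      by (auto simp: killing_eqs_def)
  qed
  then have "{c \<in> supported ?J. (p_dx \<circ> x_dp) c = 0} \<subseteq> {0}"
    by auto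
  then have "coeff_space.dim {c \<in> supported ?J. (p_dx \<circ> x_dp) c = 0} = 0"
    using coeff_space.dim_le_card[of _ "{}"] by auto
  moreover have "card ?J = coeff_space.dim {c \<in> supported ?J. (p_dx \<circ> x_dp) c = 0}
      + coeff_space.dim ((p_dx \<circ> x_dp) ` supported ?J)"
    by (rule dim_supported_rank_nullity[OF finite_killing_eqs finite_killing_eqs[of j]])
      (auto simp: p_dx_supported x_dp_supported p_dx_add p_dx_scale x_dp_add x_dp_scale)
  moreover have "coeff_space.dim ((p_dx \<circ> x_dp) ` supported ?J) \<le> coeff_space.dim (p_dx ` supported ?I)"
    by (rule coeff_space.dim_mono_of_finite[of _ _ "unit_coeff ` ?J"])
      (auto simp: finite_killing_eqs x_dp_supported p_dx_supported intro!: supported_in_span)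
  ultimately show ?thesis
    using rank_I card_killing_jets_diff[of j, where 'n = 'n] by linarith
qed

definition free_jets :: "nat \<Rightarrow> ('n::finite multiset \<times> 'n multiset) set" where
  "free_jets q = {(\<alpha>, \<beta>). size \<alpha> \<le> size \<beta> \<and> size \<beta> \<le> q}"

definition free_eqs :: "nat \<Rightarrow> ('n::finite multiset \<times> 'n multiset) set" where
  "free_eqs q = {(\<alpha>, \<beta>). size \<alpha> + 2 \<le> size \<beta> \<and> size \<beta> \<le> Suc q}"

text \<open>The operator \<open>\<Delta>\<^sub>x + 2 p\<cdot>\<partial>\<^sub>x\<close>: applied to the jet of the symbol of \<open>Q\<close>, it gives the jet of
  the symbol of the commutator of \<open>\<Delta>\<close> and \<open>Q\<close>. The two summands change the degrees in \<open>x\<close>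
  and \<open>p\<close> differently, but both map the jets supported in \<open>free_jets q\<close> to jets supported in
  \<open>free_eqs q\<close>.\<close>

definition free_op :: "('n::finite multiset \<times> 'n multiset \<Rightarrow> complex) \<Rightarrow> 'n multiset \<times> 'n multiset \<Rightarrow> complex" where
  "free_op c = (\<lambda>(\<alpha>, \<beta>). (\<Sum>a\<in>UNIV. c (add_mset a (add_mset a \<alpha>), \<beta>))
     + 2 * p_dx c (\<alpha>, \<beta>))"

lemma free_op_add: "free_op (c + d) = free_op c + free_op d"
  and free_op_scale: "free_op (scale_coeff r c) = scale_coeff r (free_op c)"
  by (auto simp: fun_eq_iff free_op_def p_dx_def scale_coeff_def sum.distrib algebra_simps
      sum_distrib_left)

lemma free_op_supported:
  assumes "c \<in> supported (free_jets q)"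
  shows "free_op c \<in> supported (free_eqs q)"
proof -
  have "free_op c (\<alpha>, \<beta>) = 0" if not: "(\<alpha>, \<beta>) \<notin> free_eqs q" for \<alpha> \<beta>
  proof -
    have "p_dx c (\<alpha>, \<beta>) = 0"
    proof (rule ccontr)
      assume "p_dx c (\<alpha>, \<beta>) \<noteq> 0"
      then obtain a where a: "a \<in># \<beta>" "c (add_mset a \<alpha>, \<beta> - {#a#}) \<noteq> 0"
        by (rule p_dx_nonzeroE)
      then have "(add_mset a \<alpha>, \<beta> - {#a#}) \<in> free_jets q"
        using assms by (auto simp: supported_def)
      with a(1) not show False
        by (auto simp: free_jets_def free_eqs_def dest!: multi_member_split)
    qed
    moreover have "c (add_mset a (add_mset a \<alpha>), \<beta>) = 0" for a
      using assms not by (auto simp: supported_def free_jets_def free_eqs_def)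
    ultimately show ?thesis
      by (simp add: free_op_def)
  qed
  then show ?thesis
    by (auto simp: supported_def)
qed

lemma free_jets_eq: "free_jets q = (\<Union>j\<le>q. killing_jets j)"
  and free_eqs_eq: "free_eqs q = (\<Union>j\<le>q. killing_eqs j)"
proof -
  show "free_jets q = (\<Union>j\<le>q. killing_jets j)"
    by (auto simp: free_jets_def killing_jets_def)
  have "\<exists>j\<in>{..q}. size \<alpha> < j \<and> size \<beta> = Suc j"
    if "size \<alpha> + 2 \<le> size \<beta>" "size \<beta> \<le> Suc q" for \<alpha> \<beta> :: "'b multiset"
    using that by (intro bexI[of _ "size \<beta> - 1"]) auto
  then show "free_eqs q = (\<Union>j\<le>q. killing_eqs j :: ('b multiset \<times> 'b multiset) set)"
    by (auto simp: free_eqs_def killing_eqs_def)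
qed

lemma finite_free_jets: "finite (free_jets q)"
  and finite_free_eqs: "finite (free_eqs q)"
  by (simp_all add: free_jets_eq free_eqs_eq finite_killing_jets finite_killing_eqs)

lemma card_free_jets: "card (free_jets q :: ('n::finite multiset \<times> 'n multiset) set)
    = (\<Sum>j\<le>q. card (killing_jets j :: ('n multiset \<times> 'n multiset) set))"
  unfolding free_jets_eq
  by (intro card_UN_disjoint) (auto simp: finite_killing_jets, auto simp: killing_jets_def)

lemma card_free_eqs: "card (free_eqs q :: ('n::finite multiset \<times> 'n multiset) set)
    = (\<Sum>j\<le>q. card (killing_eqs j :: ('n multiset \<times> 'n multiset) set))"
  unfolding free_eqs_eq
  by (intro card_UN_disjoint) (auto simp: finite_killing_eqs, auto simp: killing_eqs_def)

text \<open>There are as many unknowns as elements of \<open>free_jets q\<close> and at most as many independent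
  conditions as elements of \<open>free_eqs q\<close>. Both sets are disjoint unions over \<open>j \<le> q\<close> of the sets
  counted for the Killing tensors of rank \<open>j\<close>.\<close>

lemma N_tilde_le_dim_free_jets:
  "N_tilde CARD('n) q \<le> real (coeff_space.dim
      {c \<in> supported (free_jets q :: ('n::finite multiset \<times> 'n multiset) set). free_op c = 0})"
proof -
  let ?I = "free_jets q :: ('n multiset \<times> 'n multiset) set"
  let ?J = "free_eqs q :: ('n multiset \<times> 'n multiset) set"
  have "card ?I = coeff_space.dim {c \<in> supported ?I. free_op c = 0}
      + coeff_space.dim (free_op ` supported ?I)"
    by (rule dim_supported_rank_nullity[OF finite_free_jets finite_free_eqs[of q]])
      (auto simp: free_op_supported free_op_add free_op_scale)
  moreover have "coeff_space.dim (free_op ` supported ?I) \<le> coeff_space.dim (supported ?J)"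
    by (rule coeff_space.dim_mono_of_finite[of _ _ "unit_coeff ` ?J"])
      (auto simp: finite_free_eqs free_op_supported intro!: supported_in_span)
  then have "coeff_space.dim (free_op ` supported ?I) \<le> card ?J"
    by (simp add: dim_supported finite_free_eqs)
  moreover have "real (card ?I) - real (card ?J) = N_tilde CARD('n) q"
    unfolding card_free_jets card_free_eqs N_tilde_def
    by (simp add: sum_subtractf flip: card_killing_jets_diff[where 'n = 'n])
  ultimately show ?thesis
    by linarith
qed

section \<open>Calculus of iterated partial derivatives\<close>

lemma partial_eqI:
  "(f has_derivative D) (at x) \<Longrightarrow> partial a f x = D (axis a 1)"
  using frechet_derivative_at[of f D x] by (simp add: partial_def)

lemma partials_Nil [simp]: "partials [] f = f"
  and partials_Cons [simp]: "partials (a # as) f = partial a (partials as f)"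
  and partials_append: "partials (as @ bs) f = partials as (partials bs f)"
  by (simp_all add: partials_def)

lemma smooth_differentiable: "smooth f \<Longrightarrow> f differentiable (at x)"
  unfolding smooth_def by (erule allE[of _ "[]"]) simp

lemma smooth_partials: "smooth f \<Longrightarrow> smooth (partials as f)"
  unfolding smooth_def by (simp flip: partials_append)

lemma smooth_partial: "smooth f \<Longrightarrow> smooth (partial a f)"
  using smooth_partials[of f "[a]"] by simp

text \<open>Smoothness is the largest property of differentiable functions that is inherited by partial
  derivatives. This spares an induction over the order of differentiation when closure
  properties of smooth functions are proved.\<close>

lemma smooth_coinduct:
  assumes "X f" and "\<And>f x. X f \<Longrightarrow> f differentiable (at x)" and "\<And>f a. X f \<Longrightarrow> X (partial a f)"
  shows "smooth f"
proof -
  have "X (partials as f)" for as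
    by (induction as) (simp_all add: assms)
  then show ?thesis
    unfolding smooth_def using assms(2) by blast
qed

lemma partial_const [simp]: "partial a (\<lambda>_. c) = (\<lambda>_. 0)"
  by (rule ext) (rule partial_eqI[OF has_derivative_const])

lemma partial_add:
  assumes "f differentiable (at x)" and "g differentiable (at x)"
  shows "partial a (\<lambda>x. f x + g x) x = partial a f x + partial a g x"
  using assms unfolding frechet_derivative_works
  by (subst partial_eqI[OF has_derivative_add]) (auto simp: partial_def)

lemma partial_mult:
  fixes f g :: "real^'n::finite \<Rightarrow> complex"
  assumes "f differentiable (at x)" and "g differentiable (at x)"
  shows "partial a (\<lambda>x. f x * g x) x = partial a f x * g x + f x * partial a g x"
  using assms unfolding frechet_derivative_works
  by (subst partial_eqI[OF has_derivative_mult]) (auto simp: partial_def)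

lemma partial_bounded_linear:
  assumes "bounded_linear L" and "f differentiable (at x)"
  shows "partial a (\<lambda>x. L (f x)) x = L (partial a f x)"
  using assms(2) unfolding frechet_derivative_works
  by (subst partial_eqI[OF bounded_linear.has_derivative[OF assms(1)]]) (auto simp: partial_def)

lemma smooth_const: "smooth (\<lambda>_. c)"
  by (rule smooth_coinduct[where X = "\<lambda>f. \<exists>c. f = (\<lambda>_. c)"]) auto

lemma smooth_bounded_linear:
  assumes L: "bounded_linear L" and "smooth f"
  shows "smooth (\<lambda>x. L (f x))"
proof (rule smooth_coinduct[where X = "\<lambda>g. \<exists>f. smooth f \<and> g = (\<lambda>x. L (f x))"])
  show "\<exists>f'. smooth f' \<and> (\<lambda>x. L (f x)) = (\<lambda>x. L (f' x))"
    using assms by blast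
next
  fix g x assume "\<exists>f. smooth f \<and> g = (\<lambda>x. L (f x))"
  then obtain f where "smooth f" "g = (\<lambda>x. L (f x))"
    by blast
  then show "g differentiable (at x)"
    using bounded_linear.has_derivative[OF L] smooth_differentiable[of f x]
    unfolding differentiable_def by blast
next
  fix g a assume "\<exists>f. smooth f \<and> g = (\<lambda>x. L (f x))"
  then obtain f where f: "smooth f" "g = (\<lambda>x. L (f x))"
    by blast
  then have "partial a g = (\<lambda>x. L (partial a f x))"
    by (auto simp: partial_bounded_linear[OF L] smooth_differentiable)
  then show "\<exists>f. smooth f \<and> partial a g = (\<lambda>x. L (f x))"
    using f smooth_partial by blast
qed

text \<open>Products of smooth functions alone are not closed under partial differentiation, because of the
  Leibniz rule; the algebra generated by the smooth functions is.\<close>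

inductive smooth_alg :: "(real^'n::finite \<Rightarrow> complex) \<Rightarrow> bool" where
  "smooth f \<Longrightarrow> smooth_alg f"
| "smooth_alg f \<Longrightarrow> smooth_alg g \<Longrightarrow> smooth_alg (\<lambda>x. f x + g x)"
| "smooth_alg f \<Longrightarrow> smooth_alg g \<Longrightarrow> smooth_alg (\<lambda>x. f x * g x)"

lemma smooth_alg_step:
  "smooth_alg f \<Longrightarrow> (\<forall>x. f differentiable (at x)) \<and> (\<forall>a. smooth_alg (partial a f))"
proof (induction rule: smooth_alg.induct)
  case (1 f)
  then show ?case
    by (auto intro: smooth_alg.intros smooth_partial smooth_differentiable)
next
  case (2 f g)
  then have "partial a (\<lambda>x. f x + g x) = (\<lambda>x. partial a f x + partial a g x)" for a
    by (auto simp: partial_add)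
  with 2 show ?case
    by (auto intro: smooth_alg.intros)
next
  case (3 f g)
  then have "partial a (\<lambda>x. f x * g x) = (\<lambda>x. partial a f x * g x + f x * partial a g x)" for a
    by (auto simp: partial_mult)
  with 3 show ?case
    by (auto intro!: smooth_alg.intros(2,3))
qed

lemma smooth_alg_smooth: "smooth_alg f \<Longrightarrow> smooth f"
  by (erule smooth_coinduct) (auto dest: smooth_alg_step)

lemma smooth_add:
  fixes f g :: "real^'n::finite \<Rightarrow> complex"
  shows "smooth f \<Longrightarrow> smooth g \<Longrightarrow> smooth (\<lambda>x. f x + g x)"
  by (rule smooth_alg_smooth[OF smooth_alg.intros(2)]) (simp_all add: smooth_alg.intros(1))

lemma smooth_mult:
  fixes f g :: "real^'n::finite \<Rightarrow> complex"
  shows "smooth f \<Longrightarrow> smooth g \<Longrightarrow> smooth (\<lambda>x. f x * g x)"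
  by (rule smooth_alg_smooth[OF smooth_alg.intros(3)]) (simp_all add: smooth_alg.intros(1))

lemma smooth_sum:
  fixes f :: "'i \<Rightarrow> real^'n::finite \<Rightarrow> complex"
  shows "(\<And>i. i \<in> I \<Longrightarrow> smooth (f i)) \<Longrightarrow> smooth (\<lambda>x. \<Sum>i\<in>I. f i x)"
  by (induction I rule: infinite_finite_induct) (auto intro: smooth_const smooth_add)

lemma smooth_uminus:
  fixes f :: "real^'n::finite \<Rightarrow> complex"
  shows "smooth f \<Longrightarrow> smooth (\<lambda>x. - f x)"
  using smooth_mult[OF smooth_const[of "-1"], of f] by simp

lemma smooth_diff:
  fixes f g :: "real^'n::finite \<Rightarrow> complex"
  shows "smooth f \<Longrightarrow> smooth g \<Longrightarrow> smooth (\<lambda>x. f x - g x)"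
  using smooth_add[of f "\<lambda>x. - g x"] smooth_uminus[of g] by simp

lemmas smooth_intros = smooth_const smooth_add smooth_mult smooth_sum smooth_uminus smooth_diff
  smooth_partial smooth_partials

lemma partial_sum:
  fixes f :: "'i \<Rightarrow> real^'n::finite \<Rightarrow> complex"
  shows "(\<And>i. i \<in> I \<Longrightarrow> smooth (f i)) \<Longrightarrow>
    partial a (\<lambda>x. \<Sum>i\<in>I. f i x) = (\<lambda>x. \<Sum>i\<in>I. partial a (f i) x)"
  by (induction I rule: infinite_finite_induct)
    (auto simp: partial_add smooth_differentiable smooth_sum)

lemma partials_add:
  fixes f g :: "real^'n::finite \<Rightarrow> complex"
  assumes "smooth f" and "smooth g"
  shows "partials as (\<lambda>x. f x + g x) = (\<lambda>x. partials as f x + partials as g x)"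
  by (induction as) (simp_all add: partial_add smooth_differentiable smooth_partials assms)

lemma partials_cmult:
  fixes f :: "real^'n::finite \<Rightarrow> complex"
  assumes "smooth f"
  shows "partials as (\<lambda>x. c * f x) = (\<lambda>x. c * partials as f x)"
  by (induction as)
    (simp_all add: partial_mult smooth_differentiable smooth_partials smooth_const assms)

lemma partials_sum:
  fixes f :: "'i \<Rightarrow> real^'n::finite \<Rightarrow> complex"
  assumes "\<And>i. i \<in> I \<Longrightarrow> smooth (f i)"
  shows "partials as (\<lambda>x. \<Sum>i\<in>I. f i x) = (\<lambda>x. \<Sum>i\<in>I. partials as (f i) x)"
  by (induction as) (simp_all add: partial_sum smooth_partials assms)

lemma partials_zero: "partials as (\<lambda>_. 0) = (\<lambda>_. 0)"
  by (induction as) simp_all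

lemma has_real_derivative_along_axis:
  fixes g :: "real^'n::finite \<Rightarrow> real"
  assumes "g differentiable (at (z + t *\<^sub>R axis a 1))"
  shows "((\<lambda>t. g (z + t *\<^sub>R axis a 1)) has_real_derivative partial a g (z + t *\<^sub>R axis a 1)) (at t)"
proof -
  let ?D = "frechet_derivative g (at (z + t *\<^sub>R axis a 1))"
  have D: "(g has_derivative ?D) (at (z + t *\<^sub>R axis a 1))"
    using assms by (simp add: frechet_derivative_works)
  have "((\<lambda>t. z + t *\<^sub>R axis a 1) has_derivative (\<lambda>h. h *\<^sub>R axis a 1)) (at t)"
    by (auto intro!: derivative_eq_intros)
  from has_derivative_compose[OF this, of g ?D]
  have "((\<lambda>t. g (z + t *\<^sub>R axis a 1)) has_derivative (\<lambda>h. ?D (h *\<^sub>R axis a 1))) (at t)"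
    using D by simp
  moreover have "?D (h *\<^sub>R axis a 1) = partial a g (z + t *\<^sub>R axis a 1) * h" for h
    using linear_scale[OF has_derivative_linear[OF D]] by (simp add: partial_def mult.commute)
  ultimately show ?thesis
    by (simp add: has_field_derivative_def)
qed

text \<open>The mean value theorem in direction \<open>a\<close> and then in direction \<open>b\<close>. The left hand side is
  symmetric in \<open>a\<close> and \<open>b\<close>, and this is why the mixed derivatives agree.\<close>

lemma second_difference:
  fixes g :: "real^'n::finite \<Rightarrow> real"
  assumes g: "\<And>x. g differentiable (at x)" and g': "\<And>x. partial a g differentiable (at x)"
    and h: "h > 0"
  shows "\<exists>s t. 0 < s \<and> s < h \<and> 0 < t \<and> t < h \<and>
    g (x + h *\<^sub>R axis a 1 + h *\<^sub>R axis b 1) - g (x + h *\<^sub>R axis a 1) - g (x + h *\<^sub>R axis b 1) + g x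
      = h\<^sup>2 * partial b (partial a g) (x + s *\<^sub>R axis a 1 + t *\<^sub>R axis b 1)"
proof -
  define \<phi> where "\<phi> s = g ((x + h *\<^sub>R axis b 1) + s *\<^sub>R axis a 1) - g (x + s *\<^sub>R axis a 1)" for s
  have d\<phi>: "DERIV \<phi> s :> partial a g ((x + h *\<^sub>R axis b 1) + s *\<^sub>R axis a 1)
      - partial a g (x + s *\<^sub>R axis a 1)" for s
    unfolding \<phi>_def by (intro DERIV_diff has_real_derivative_along_axis g)
  then obtain s where s: "0 < s" "s < h"
    "\<phi> h - \<phi> 0 = h * (partial a g ((x + h *\<^sub>R axis b 1) + s *\<^sub>R axis a 1)
      - partial a g (x + s *\<^sub>R axis a 1))"
    using MVT2[OF h d\<phi>] by auto
  have dg: "DERIV (\<lambda>t. partial a g ((x + s *\<^sub>R axis a 1) + t *\<^sub>R axis b 1)) t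
      :> partial b (partial a g) ((x + s *\<^sub>R axis a 1) + t *\<^sub>R axis b 1)" for t
    by (intro has_real_derivative_along_axis g')
  then obtain t where t: "0 < t" "t < h"
    "partial a g ((x + s *\<^sub>R axis a 1) + h *\<^sub>R axis b 1) - partial a g (x + s *\<^sub>R axis a 1)
      = h * partial b (partial a g) ((x + s *\<^sub>R axis a 1) + t *\<^sub>R axis b 1)"
    using MVT2[OF h dg] by auto
  have "\<phi> h - \<phi> 0 = g (x + h *\<^sub>R axis a 1 + h *\<^sub>R axis b 1) - g (x + h *\<^sub>R axis a 1)
      - g (x + h *\<^sub>R axis b 1) + g x"
    by (simp add: \<phi>_def algebra_simps)
  moreover have "(x + h *\<^sub>R axis b 1) + s *\<^sub>R axis a 1 = (x + s *\<^sub>R axis a 1) + h *\<^sub>R axis b 1"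
    by (simp add: algebra_simps)
  ultimately show ?thesis
    using s t by (intro exI[of _ s] exI[of _ t]) (simp add: power2_eq_square)
qed

lemma partial_commute_real:
  fixes g :: "real^'n::finite \<Rightarrow> real"
  assumes g: "smooth g"
  shows "partial a (partial b g) = partial b (partial a g)"
proof
  fix x
  have cont: "isCont (partial a (partial b g)) x" for a b
    using g by (intro differentiable_imp_continuous_within smooth_differentiable smooth_partial)
  \<comment> \<open>by continuity, the second difference quotient tends to the mixed derivative\<close>
  have close: "\<exists>d>0. \<forall>h. 0 < h \<and> h < d \<longrightarrow>
      \<bar>(g (x + h *\<^sub>R axis a 1 + h *\<^sub>R axis b 1) - g (x + h *\<^sub>R axis a 1) - g (x + h *\<^sub>R axis b 1) + g x) / h\<^sup>2
        - partial b (partial a g) x\<bar> < e" if "e > 0" for e a b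
  proof -
    obtain d where d: "d > 0"
      "\<And>y. norm (y - x) < d \<Longrightarrow> \<bar>partial b (partial a g) y - partial b (partial a g) x\<bar> < e"
      using cont[of b a] \<open>e > 0\<close> unfolding continuous_at_eps_delta by (auto simp: dist_norm)
    show ?thesis
    proof (intro exI[of _ "d / 2"] conjI allI impI)
      fix h assume h: "0 < h \<and> h < d / 2"
      obtain s t where st: "0 < s" "s < h" "0 < t" "t < h"
        "g (x + h *\<^sub>R axis a 1 + h *\<^sub>R axis b 1) - g (x + h *\<^sub>R axis a 1) - g (x + h *\<^sub>R axis b 1) + g x
          = h\<^sup>2 * partial b (partial a g) (x + s *\<^sub>R axis a 1 + t *\<^sub>R axis b 1)"
        using second_difference[of g a h x b] g h by (auto intro: smooth_differentiable smooth_partial)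
      have "norm (s *\<^sub>R axis a 1 + t *\<^sub>R axis b 1 :: real^'n) \<le> s + t"
        using norm_triangle_ineq[of "s *\<^sub>R axis a 1" "t *\<^sub>R axis b 1 :: real^'n"] st by simp
      then show "\<bar>(g (x + h *\<^sub>R axis a 1 + h *\<^sub>R axis b 1) - g (x + h *\<^sub>R axis a 1)
          - g (x + h *\<^sub>R axis b 1) + g x) / h\<^sup>2 - partial b (partial a g) x\<bar> < e"
        using st h d(2)[of "x + s *\<^sub>R axis a 1 + t *\<^sub>R axis b 1"] by (simp add: add.assoc)
    qed (use d in simp)
  qed
  show "partial a (partial b g) x = partial b (partial a g) x"
  proof (rule ccontr)
    assume neq: "\<not> ?thesis"
    define e where "e = \<bar>partial a (partial b g) x - partial b (partial a g) x\<bar> / 2"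
    then have "e > 0"
      using neq by simp
    obtain d1 d2 where d: "d1 > 0" "d2 > 0"
      "\<And>h. 0 < h \<Longrightarrow> h < d1 \<Longrightarrow>
        \<bar>(g (x + h *\<^sub>R axis a 1 + h *\<^sub>R axis b 1) - g (x + h *\<^sub>R axis a 1) - g (x + h *\<^sub>R axis b 1) + g x) / h\<^sup>2
          - partial b (partial a g) x\<bar> < e"
      "\<And>h. 0 < h \<Longrightarrow> h < d2 \<Longrightarrow>
        \<bar>(g (x + h *\<^sub>R axis b 1 + h *\<^sub>R axis a 1) - g (x + h *\<^sub>R axis b 1) - g (x + h *\<^sub>R axis a 1) + g x) / h\<^sup>2
          - partial a (partial b g) x\<bar> < e"
      using close[OF \<open>e > 0\<close>, of a b] close[OF \<open>e > 0\<close>, of b a] by blast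
    define h where "h = min d1 d2 / 2"
    have h: "0 < h" "h < d1" "h < d2"
      using d by (auto simp: h_def)
    define X where "X = (g (x + h *\<^sub>R axis a 1 + h *\<^sub>R axis b 1) - g (x + h *\<^sub>R axis a 1)
      - g (x + h *\<^sub>R axis b 1) + g x) / h\<^sup>2"
    have X_swap: "X = (g (x + h *\<^sub>R axis b 1 + h *\<^sub>R axis a 1) - g (x + h *\<^sub>R axis b 1)
      - g (x + h *\<^sub>R axis a 1) + g x) / h\<^sup>2"
      by (simp add: X_def algebra_simps)
    have "\<bar>X - partial b (partial a g) x\<bar> < e"
      using d(3)[OF h(1,2)] by (simp only: X_def)
    moreover have "\<bar>X - partial a (partial b g) x\<bar> < e"
      using d(4)[OF h(1,3)] by (simp only: X_swap)
    ultimately show False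
      unfolding e_def by (simp add: abs_if split: if_splits)
  qed
qed

lemma partial_commute:
  fixes f :: "real^'n::finite \<Rightarrow> complex"
  assumes f: "smooth f"
  shows "partial a (partial b f) = partial b (partial a f)"
proof -
  have *: "(\<lambda>x. L (partial a (partial b f) x)) = (\<lambda>x. L (partial b (partial a f) x))"
    if L: "bounded_linear L" for L :: "complex \<Rightarrow> real"
  proof -
    have "partial b (\<lambda>x. L (f x)) = (\<lambda>x. L (partial b f x))"
      "partial a (\<lambda>x. L (partial b f x)) = (\<lambda>x. L (partial a (partial b f) x))" for a b
      using f by (auto simp: partial_bounded_linear[OF L] smooth_differentiable smooth_partial)
    then have "(\<lambda>x. L (partial a (partial b f) x)) = partial a (partial b (\<lambda>x. L (f x)))" for a b
      by simp
    then show ?thesis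
      by (metis partial_commute_real smooth_bounded_linear L f)
  qed
  show ?thesis
    using *[OF bounded_linear_Re] *[OF bounded_linear_Im] by (auto simp: complex_eq_iff fun_eq_iff)
qed

lemma partials_partial_commute:
  fixes f :: "real^'n::finite \<Rightarrow> complex"
  assumes "smooth f"
  shows "partials as (partial a f) = partial a (partials as f)"
  by (induction as) (simp_all add: partial_commute[OF smooth_partials[OF assms]])

lemma partials_mset_eq:
  fixes f :: "real^'n::finite \<Rightarrow> complex"
  assumes f: "smooth f"
  shows "mset as = mset bs \<Longrightarrow> partials as f = partials bs f"
proof (induction as arbitrary: bs)
  case (Cons a as)
  then obtain us vs where bs: "bs = us @ a # vs"
    by (metis list.set_intros(1) mset_eq_setD split_list)
  then have "partials as f = partials (us @ vs) f"
    using Cons by simp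
  then show ?case
    by (simp add: bs partials_append partials_partial_commute smooth_partials f)
qed simp

text \<open>Smooth functions have symmetric iterated derivatives, so any enumeration of the multi-index
  will do.\<close>

definition mpartial :: "'n::finite multiset \<Rightarrow> (real^'n \<Rightarrow> complex) \<Rightarrow> real^'n \<Rightarrow> complex" where
  "mpartial \<alpha> f = partials (SOME as. mset as = \<alpha>) f"

lemma mpartial_mset: "smooth f \<Longrightarrow> mpartial (mset as) f = partials as f"
  unfolding mpartial_def by (rule partials_mset_eq) (auto intro: someI)

lemma mpartial_empty: "mpartial {#} f = f"
  by (simp add: mpartial_def)

lemma mpartial_partials:
  obtains as where "mset as = \<alpha>" and "\<And>f. mpartial \<alpha> f = partials as f"
  using someI_ex[OF ex_mset[of \<alpha>]] by (auto simp: mpartial_def)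

lemma mpartial_add_mset: "smooth f \<Longrightarrow> mpartial (add_mset a \<alpha>) f = partial a (mpartial \<alpha> f)"
  by (metis ex_mset mpartial_mset mset.simps(2) partials_Cons)

lemma smooth_mpartial: "smooth f \<Longrightarrow> smooth (mpartial \<alpha> f)"
  by (simp add: mpartial_def smooth_partials)

lemma mpartial_partial: "smooth f \<Longrightarrow> mpartial \<alpha> (partial a f) = mpartial (add_mset a \<alpha>) f"
  by (metis mpartial_add_mset mpartial_def partials_partial_commute)

lemma constant_if_partial_eq_zero:
  fixes f :: "real^'n::finite \<Rightarrow> complex"
  assumes f: "\<And>x. f differentiable (at x)" and zero: "\<And>a. partial a f = (\<lambda>_. 0)"
  shows "f x = f y"
proof -
  have "(f has_derivative (\<lambda>_. 0)) (at z)" for z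
  proof -
    let ?D = "frechet_derivative f (at z)"
    have D: "(f has_derivative ?D) (at z)"
      using f by (simp add: frechet_derivative_works)
    have "?D (axis a 1) = 0" for a
      using fun_cong[OF zero, of a z] by (simp add: partial_def)
    then have "?D b = 0" if "b \<in> Basis" for b
      using that unfolding Basis_vec_def by auto
    then have "?D v = 0" for v
      using linear_eq_0_on_span[OF has_derivative_linear[OF D], of Basis v] by simp
    then have "?D = (\<lambda>_. 0)"
      by (rule ext)
    with D show ?thesis
      by simp
  qed
  then have "\<exists>c. \<forall>z\<in>UNIV. f z = c"
    by (intro has_derivative_zero_constant) auto
  then show ?thesis
    by auto
qed

text \<open>Descending induction on the order: if all derivatives of order \<open>k + 1\<close> vanish identically, then
  those of order \<open>k\<close> are constant, and they vanish at the origin.\<close>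

lemma zero_if_jet_zero:
  fixes f :: "real^'n::finite \<Rightarrow> complex"
  assumes f: "smooth f"
    and top: "\<And>\<alpha>. size \<alpha> = Suc q \<Longrightarrow> mpartial \<alpha> f = (\<lambda>_. 0)"
    and jet: "\<And>\<alpha>. size \<alpha> \<le> q \<Longrightarrow> mpartial \<alpha> f 0 = 0"
  shows "f = (\<lambda>_. 0)"
proof -
  have "k \<le> Suc q \<Longrightarrow> size \<alpha> = Suc q - k \<Longrightarrow> mpartial \<alpha> f = (\<lambda>_. 0)" for k \<alpha>
  proof (induction k arbitrary: \<alpha>)
    case (Suc k)
    have "partial a (mpartial \<alpha> f) = (\<lambda>_. 0)" for a
      using Suc by (simp flip: mpartial_add_mset[OF f])
    then have "mpartial \<alpha> f x = mpartial \<alpha> f 0" for x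
      by (intro constant_if_partial_eq_zero smooth_differentiable smooth_mpartial f)
    then show ?case
      using jet[of \<alpha>] Suc.prems by auto
  qed (use top in simp)
  from this[of "Suc q" "{#}"] show ?thesis
    by (simp add: mpartial_empty)
qed

section \<open>Monomials\<close>

text \<open>The test functions \<open>(x - z)\<^bsup>\<beta>\<^esup>\<close>. At \<open>z\<close> exactly one of their derivatives is nonzero, namely
  the one of multi-index \<open>\<beta>\<close>, with value \<open>\<beta>!\<close>; in this way they read off coefficients of
  differential operators.\<close>

definition mon :: "real^'n \<Rightarrow> 'n multiset \<Rightarrow> real^'n \<Rightarrow> complex" where
  "mon z \<beta> x = (\<Prod>a\<in>#\<beta>. of_real (x $ a - z $ a))"

text \<open>The multi-index factorial \<open>\<beta>!\<close>.\<close>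

definition mfact :: "'n::finite multiset \<Rightarrow> nat" where
  "mfact \<beta> = (\<Prod>a\<in>UNIV. fact (count \<beta> a))"

lemma mfact_pos: "mfact \<beta> \<noteq> 0"
  by (simp add: mfact_def)

lemma mfact_add_mset: "mfact (add_mset a \<beta>) = Suc (count \<beta> a) * mfact \<beta>"
  unfolding mfact_def by (simp add: prod.remove[of UNIV a] algebra_simps)

lemma mon_empty: "mon z {#} = (\<lambda>_. 1)"
  and mon_add_mset: "mon z (add_mset a \<beta>) = (\<lambda>x. of_real (x $ a - z $ a) * mon z \<beta> x)"
  by (auto simp: mon_def)

lemma coord_has_derivative:
  "((\<lambda>x. of_real (x $ a - z $ a) :: complex) has_derivative (\<lambda>h. of_real (h $ a))) (at x)"
  by (auto intro!: derivative_eq_intros bounded_linear_imp_has_derivative bounded_linear_vec_nth)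

lemma partial_coord:
  "partial b (\<lambda>x. of_real (x $ a - z $ a) :: complex) = (\<lambda>_. if a = b then 1 else 0)"
  by (rule ext, subst partial_eqI[OF coord_has_derivative]) (simp add: axis_def)

lemma smooth_coord: "smooth (\<lambda>x. of_real (x $ a - z $ a) :: complex)"
proof -
  let ?u = "\<lambda>x. of_real (x $ a - z $ a) :: complex"
  show ?thesis
  proof (rule smooth_coinduct[where X = "\<lambda>f. f = ?u \<or> (\<exists>c. f = (\<lambda>_. c))"])
    show "f differentiable (at x)" if "f = ?u \<or> (\<exists>c. f = (\<lambda>_. c))" for f x
      using that differentiableI[OF coord_has_derivative[of a z x]] by auto
    show "partial b f = ?u \<or> (\<exists>c. partial b f = (\<lambda>_. c))" if "f = ?u \<or> (\<exists>c. f = (\<lambda>_. c))" for f b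
      using that partial_coord[of b a z] partial_const by blast
  qed simp
qed

lemma smooth_mon: "smooth (mon z \<beta>)"
  by (induction \<beta>) (simp_all only: mon_empty mon_add_mset smooth_const smooth_mult smooth_coord)

lemma partial_mon:
  "partial a (mon z \<beta>) = (\<lambda>x. of_nat (count \<beta> a) * mon z (\<beta> - {#a#}) x)"
proof (induction \<beta>)
  case empty
  show ?case
    by (simp only: mon_empty partial_const) simp
next
  case (add b \<beta>)
  define u :: "real^'a \<Rightarrow> complex" where "u = (\<lambda>x. of_real (x $ b - z $ b))"
  have u: "smooth u" "partial a u = (\<lambda>_. if a = b then 1 else 0)"
    unfolding u_def by (rule smooth_coord) (subst partial_coord, auto)
  have mon_u: "mon z (add_mset b \<gamma>) = (\<lambda>x. u x * mon z \<gamma> x)" for \<gamma>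
    by (simp only: u_def mon_add_mset)
  show ?case
  proof
    fix x
    have "partial a (mon z (add_mset b \<beta>)) x = partial a u x * mon z \<beta> x + u x * partial a (mon z \<beta>) x"
      unfolding mon_u by (intro partial_mult smooth_differentiable u smooth_mon)
    also have "\<dots> = (if a = b then mon z \<beta> x else 0)
        + of_nat (count \<beta> a) * mon z (add_mset b (\<beta> - {#a#})) x"
      unfolding add.IH u(2) mon_u by simp
    also have "\<dots> = of_nat (count (add_mset b \<beta>) a) * mon z (add_mset b \<beta> - {#a#}) x"
    proof (cases "a \<in># \<beta>")
      case True
      then obtain \<beta>' where "\<beta> = add_mset a \<beta>'"
        by (blast dest: multi_member_split)
      moreover have "add_mset b (add_mset a \<beta>') - {#a#} = add_mset b \<beta>'"
        by (simp add: add_mset_commute[of b a])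
      ultimately show ?thesis
        by (simp add: distrib_right)
    qed (auto simp: not_in_iff)
    finally show "partial a (mon z (add_mset b \<beta>)) x
      = of_nat (count (add_mset b \<beta>) a) * mon z (add_mset b \<beta> - {#a#}) x" .
  qed
qed

lemma mon_center: "mon z \<beta> z = (if \<beta> = {#} then 1 else 0)"
  by (cases \<beta>) (simp_all add: mon_def)

lemma partials_mon_center:
  "partials as (mon z \<beta>) z = (if mset as = \<beta> then of_nat (mfact \<beta>) else 0)"
proof (induction as arbitrary: \<beta> rule: rev_induct)
  case Nil
  then show ?case
    by (simp add: mon_center mfact_def)
next
  case (snoc a as)
  have "partials (as @ [a]) (mon z \<beta>) z = of_nat (count \<beta> a) * partials as (mon z (\<beta> - {#a#})) z"
    by (simp add: partials_append partial_mon partials_cmult smooth_mon)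
  also have "\<dots> = (if mset (as @ [a]) = \<beta> then of_nat (mfact \<beta>) else 0)"
  proof (cases "a \<in># \<beta>")
    case True
    then obtain \<beta>' where \<beta>: "\<beta> = add_mset a \<beta>'"
      by (blast dest: multi_member_split)
    then show ?thesis
      by (simp add: snoc.IH mfact_add_mset algebra_simps)
  qed (auto simp: not_in_iff)
  finally show ?case .
qed

section \<open>Differential operators and their symbols\<close>

text \<open>Collecting the equal terms of \<open>diff_op\<close> gives one coefficient per multi-index, and these
  coefficients are unique.\<close>

definition multi_op :: "nat \<Rightarrow> ('n::finite multiset \<Rightarrow> real^'n \<Rightarrow> complex) \<Rightarrow> 'n operator" where
  "multi_op q B f =
    (if smooth f then (\<lambda>x. \<Sum>\<beta> | size \<beta> \<le> q. B \<beta> x * mpartial \<beta> f x) else (\<lambda>_. 0))"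

lemma finite_lists_mset: "finite {as. mset as = \<beta>}"
proof (rule finite_subset)
  show "{as. mset as = \<beta>} \<subseteq> {as. set as \<subseteq> set_mset \<beta> \<and> length as = size \<beta>}"
    by auto
qed (rule finite_lists_length_eq, simp)

lemma card_lists_mset: "card {as. mset as = \<beta>} \<noteq> 0"
  using ex_mset[of \<beta>] finite_lists_mset[of \<beta>] by auto

lemma finite_lists_length: "finite {as :: 'n::finite list. length as = j}"
  using finite_lists_length_eq[of "UNIV :: 'n set" j] by simp

lemma diff_op_eq_multi_op:
  fixes b :: "'n::finite list \<Rightarrow> real^'n \<Rightarrow> complex"
  assumes "\<And>as. b as = b' (mset as)"
  shows "diff_op q b = multi_op q (\<lambda>\<beta> x. of_nat (card {as. mset as = \<beta>}) * b' \<beta> x)"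
proof (intro ext)
  fix f :: "real^'n \<Rightarrow> complex" and x
  let ?g = "\<lambda>\<beta>. b' \<beta> x * mpartial \<beta> f x"
  let ?L = "{as :: 'n list. length as \<le> q}"
  have L: "?L = (\<Union>j\<le>q. {as. length as = j})"
    by auto
  then have finite_L: "finite ?L"
    by (simp add: finite_lists_length)
  show "diff_op q b f x = multi_op q (\<lambda>\<beta> x. of_nat (card {as. mset as = \<beta>}) * b' \<beta> x) f x"
  proof (cases "smooth f")
    case True
    then have "diff_op q b f x = (\<Sum>j\<le>q. \<Sum>as | length as = j. ?g (mset as))"
      by (simp add: diff_op_def assms mpartial_mset)
    also have "\<dots> = (\<Sum>as\<in>?L. ?g (mset as))"
      unfolding L by (subst sum.UNION_disjoint) (auto simp: finite_lists_length)
    also have "\<dots> = (\<Sum>\<beta> | size \<beta> \<le> q. \<Sum>as | as \<in> ?L \<and> mset as = \<beta>. ?g (mset as))"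
      by (rule sum.group[symmetric]) (auto simp: finite_L finite_multisets_size_le)
    also have "\<dots> = (\<Sum>\<beta> | size \<beta> \<le> q. of_nat (card {as. mset as = \<beta>}) * ?g \<beta>)"
    proof (rule sum.cong[OF refl])
      fix \<beta> :: "'n multiset" assume "\<beta> \<in> {\<beta>. size \<beta> \<le> q}"
      then have "{as. as \<in> ?L \<and> mset as = \<beta>} = {as. mset as = \<beta>}"
        by auto
      then show "(\<Sum>as | as \<in> ?L \<and> mset as = \<beta>. ?g (mset as)) = of_nat (card {as. mset as = \<beta>}) * ?g \<beta>"
        by simp
    qed
    finally show ?thesis
      using True by (simp add: multi_op_def mult.assoc)
  qed (simp add: diff_op_def multi_op_def)
qed

lemma diff_ops_eq_multi_op:
  "(diff_ops q :: 'n::finite operator set) = {multi_op q B | B. \<forall>\<beta>. smooth (B \<beta>)}"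
proof (intro equalityI subsetI)
  fix Q :: "'n operator" assume "Q \<in> diff_ops q"
  then obtain b where b: "Q = diff_op q b" "symmetric_coeffs b" "\<And>as. smooth (b as)"
    by (auto simp: diff_ops_def)
  define b' where "b' \<beta> = b (SOME as. mset as = \<beta>)" for \<beta>
  have "b as = b' (mset as)" for as
  proof -
    have "mset as = mset (SOME bs. mset bs = mset as)"
      by (rule someI[of "\<lambda>bs. mset bs = mset as", symmetric]) (rule refl)
    then show ?thesis
      unfolding b'_def by (rule b(2)[unfolded symmetric_coeffs_def, rule_format])
  qed
  then have "Q = multi_op q (\<lambda>\<beta> x. of_nat (card {as. mset as = \<beta>}) * b' \<beta> x)"
    unfolding b(1) by (rule diff_op_eq_multi_op)
  moreover have "smooth (\<lambda>x. of_nat (card {as. mset as = \<beta>}) * b' \<beta> x)" for \<beta>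
    unfolding b'_def by (intro smooth_mult smooth_const b(3))
  ultimately show "Q \<in> {multi_op q B | B. \<forall>\<beta>. smooth (B \<beta>)}"
    by auto
next
  fix Q :: "'n operator" assume "Q \<in> {multi_op q B | B. \<forall>\<beta>. smooth (B \<beta>)}"
  then obtain B where B: "Q = multi_op q B" "\<And>\<beta>. smooth (B \<beta>)"
    by auto
  define b' where "b' \<beta> = (\<lambda>x. inverse (of_nat (card {as. mset as = \<beta>})) * B \<beta> x)" for \<beta>
  have "diff_op q (\<lambda>as. b' (mset as))
      = multi_op q (\<lambda>\<beta> x. of_nat (card {as. mset as = \<beta>}) * b' \<beta> x)"
    by (rule diff_op_eq_multi_op) simp
  also have "\<dots> = Q"
  proof -
    have "of_nat (card {as. mset as = \<beta>}) * b' \<beta> x = B \<beta> x" for \<beta> x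
      using card_lists_mset[of \<beta>] by (simp add: b'_def)
    then show ?thesis
      by (simp only: B(1))
  qed
  finally have "Q = diff_op q (\<lambda>as. b' (mset as))"
    by simp
  moreover have "symmetric_coeffs (\<lambda>as. b' (mset as))"
    by (simp add: symmetric_coeffs_def)
  moreover have "smooth (b' (mset as))" for as
    unfolding b'_def by (intro smooth_mult smooth_const B(2))
  ultimately show "Q \<in> diff_ops q"
    by (auto simp: diff_ops_def)
qed

lemma smooth_multi_op:
  assumes "\<And>\<beta>. smooth (B \<beta>)"
  shows "smooth (multi_op q B f)"
  unfolding multi_op_def using assms
  by (auto intro!: smooth_const smooth_sum smooth_mult smooth_mpartial)

text \<open>For \<open>Q = \<Sum>\<^sub>\<beta> B\<^sub>\<beta> \<partial>\<^bsup>\<beta>\<^esup>\<close> this is \<open>\<beta>! B\<^sub>\<beta>\<close>. It is defined from the action of \<open>Q\<close> and not from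
  chosen coefficients, which makes it linear in \<open>Q\<close> without further argument. The factor \<open>\<beta>!\<close>
  turns the Killing equation into \<open>p_dx = 0\<close>.\<close>

definition symb :: "'n::finite operator \<Rightarrow> 'n multiset \<Rightarrow> real^'n \<Rightarrow> complex" where
  "symb Q \<beta> = (\<lambda>z. Q (mon z \<beta>) z)"

lemma mpartial_mon_center:
  "mpartial \<gamma> (mon z \<beta>) z = (if \<gamma> = \<beta> then of_nat (mfact \<beta>) else 0)"
  using partials_mon_center mpartial_partials by metis

lemma symb_multi_op:
  "symb (multi_op q B) \<beta> = (\<lambda>z. if size \<beta> \<le> q then of_nat (mfact \<beta>) * B \<beta> z else 0)"
proof
  fix z
  have "symb (multi_op q B) \<beta> z
      = (\<Sum>\<gamma> | size \<gamma> \<le> q. if \<gamma> = \<beta> then of_nat (mfact \<beta>) * B \<beta> z else 0)"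
    by (auto simp: symb_def multi_op_def smooth_mon mpartial_mon_center intro!: sum.cong)
  then show "symb (multi_op q B) \<beta> z = (if size \<beta> \<le> q then of_nat (mfact \<beta>) * B \<beta> z else 0)"
    by (simp add: finite_multisets_size_le)
qed

lemma smooth_symb: "Q \<in> diff_ops q \<Longrightarrow> smooth (symb Q \<beta>)"
  unfolding diff_ops_eq_multi_op
  by (cases "size \<beta> \<le> q") (auto simp: symb_multi_op intro!: smooth_mult smooth_const)

lemma diff_ops_symb_eq:
  assumes "Q \<in> diff_ops q"
  shows "Q = multi_op q (\<lambda>\<beta> z. symb Q \<beta> z / of_nat (mfact \<beta>))"
proof -
  obtain B where B: "Q = multi_op q B"
    using assms unfolding diff_ops_eq_multi_op by blast
  show ?thesis
    unfolding B symb_multi_op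
    by (auto simp: multi_op_def mfact_pos fun_eq_iff intro!: sum.cong)
qed

section \<open>Commutation with a second order operator\<close>

text \<open>Every Hamiltonian \<open>((p - e A)\<^sup>2 + V) / 2\<close> has this form, and only the leading part \<open>-\<Delta>/2\<close>
  matters for the Killing equation.\<close>

definition second_order ::
    "('n::finite \<Rightarrow> real^'n \<Rightarrow> complex) \<Rightarrow> (real^'n \<Rightarrow> complex) \<Rightarrow> 'n operator" where
  "second_order u w f = (\<lambda>x. - (1 / 2) * (\<Sum>a\<in>UNIV. partial a (partial a f) x)
     + (\<Sum>a\<in>UNIV. u a x * partial a f x) + w x * f x)"

lemma smooth_second_order:
  assumes "\<And>a. smooth (u a)" and "smooth w" and "smooth f"
  shows "smooth (second_order u w f)"
  unfolding second_order_def by (intro smooth_intros assms)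

text \<open>In the Leibniz expansion every other term contains a derivative of \<open>g\<close> of lower order.\<close>

lemma partials_mult_flat:
  fixes h g :: "real^'n::finite \<Rightarrow> complex"
  assumes "smooth h" and "smooth g"
    and "\<And>bs. length bs < length as \<Longrightarrow> partials bs g z = 0"
  shows "partials as (\<lambda>x. h x * g x) z = h z * partials as g z"
  using assms
proof (induction as arbitrary: h g rule: rev_induct)
  case (snoc a as)
  have "partial a (\<lambda>x. h x * g x) = (\<lambda>x. partial a h x * g x + h x * partial a g x)"
    using snoc.prems(1,2) by (auto simp: partial_mult smooth_differentiable)
  then have "partials (as @ [a]) (\<lambda>x. h x * g x) z
      = partials as (\<lambda>x. partial a h x * g x) z + partials as (\<lambda>x. h x * partial a g x) z"
    using snoc.prems(1,2)
    by (simp add: partials_append partials_add smooth_mult smooth_partial)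
  also have "partials as (\<lambda>x. partial a h x * g x) z = partial a h z * partials as g z"
    using snoc.prems by (intro snoc.IH) (auto intro: smooth_partial)
  also have "partials as g z = 0"
    using snoc.prems(3) by simp
  also have "partials as (\<lambda>x. h x * partial a g x) z = h z * partials as (partial a g) z"
    using snoc.prems snoc.prems(3)[of "bs @ [a]" for bs]
    by (intro snoc.IH) (auto intro: smooth_partial simp: partials_append)
  finally show ?case
    by (simp add: partials_append)
qed simp

lemma partial_partial_mult:
  fixes f g :: "real^'n::finite \<Rightarrow> complex"
  assumes "smooth f" and "smooth g"
  shows "partial a (\<lambda>x. f x * g x) = (\<lambda>x. partial a f x * g x + f x * partial a g x)"
    and "partial a (partial a (\<lambda>x. f x * g x)) = (\<lambda>x. partial a (partial a f) x * g x
      + 2 * (partial a f x * partial a g x) + f x * partial a (partial a g) x)"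
proof -
  show *: "partial a (\<lambda>x. f x * g x) = (\<lambda>x. partial a f x * g x + f x * partial a g x)"
    using assms by (auto simp: partial_mult smooth_differentiable)
  have "partial a (partial a (\<lambda>x. f x * g x)) x = partial a (partial a f) x * g x
      + 2 * (partial a f x * partial a g x) + f x * partial a (partial a g) x" for x
    unfolding * using assms
    by (simp add: partial_add partial_mult smooth_differentiable smooth_mult smooth_partial
        algebra_simps)
  then show "partial a (partial a (\<lambda>x. f x * g x)) = (\<lambda>x. partial a (partial a f) x * g x
      + 2 * (partial a f x * partial a g x) + f x * partial a (partial a g) x)"
    by blast
qed

text \<open>The mixed term of the Laplacian of a product is the only one that differentiates both factors.
  With \<open>f\<close> a coefficient of \<open>Q\<close> it is the source of the Killing equation.\<close>

lemma second_order_mult: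
  assumes "smooth f" and "smooth g"
  shows "second_order u w (\<lambda>x. f x * g x) = (\<lambda>x. f x * second_order u w g x
    - (\<Sum>a\<in>UNIV. partial a f x * partial a g x)
    + (second_order u (\<lambda>_. 0) f x) * g x)"
proof
  fix x
  have "(\<Sum>a\<in>UNIV. partial a (partial a (\<lambda>x. f x * g x)) x)
      = (\<Sum>a\<in>UNIV. partial a (partial a f) x) * g x
        + 2 * (\<Sum>a\<in>UNIV. partial a f x * partial a g x)
        + f x * (\<Sum>a\<in>UNIV. partial a (partial a g) x)"
    unfolding partial_partial_mult(2)[OF assms]
    by (simp add: sum.distrib sum_distrib_left sum_distrib_right)
  moreover have "(\<Sum>a\<in>UNIV. u a x * partial a (\<lambda>x. f x * g x) x)
      = (\<Sum>a\<in>UNIV. u a x * partial a f x) * g x + f x * (\<Sum>a\<in>UNIV. u a x * partial a g x)"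
    unfolding partial_partial_mult(1)[OF assms]
    by (simp add: sum.distrib sum_distrib_left sum_distrib_right algebra_simps)
  ultimately show "second_order u w (\<lambda>x. f x * g x) x = f x * second_order u w g x
    - (\<Sum>a\<in>UNIV. partial a f x * partial a g x)
    + (second_order u (\<lambda>_. 0) f x) * g x"
    by (simp add: second_order_def algebra_simps)
qed

lemma second_order_sum:
  assumes "finite I" and "\<And>i. i \<in> I \<Longrightarrow> smooth (f i)"
  shows "second_order u w (\<lambda>x. \<Sum>i\<in>I. f i x) = (\<lambda>x. \<Sum>i\<in>I. second_order u w (f i) x)"
proof
  fix x
  have "(\<Sum>a\<in>UNIV. partial a (partial a (\<lambda>x. \<Sum>i\<in>I. f i x)) x)
      = (\<Sum>a\<in>UNIV. \<Sum>i\<in>I. partial a (partial a (f i)) x)"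
    using assms by (simp add: partial_sum smooth_partial)
  also have "\<dots> = (\<Sum>i\<in>I. \<Sum>a\<in>UNIV. partial a (partial a (f i)) x)"
    by (rule sum.swap)
  finally have 1: "(\<Sum>a\<in>UNIV. partial a (partial a (\<lambda>x. \<Sum>i\<in>I. f i x)) x)
      = (\<Sum>i\<in>I. \<Sum>a\<in>UNIV. partial a (partial a (f i)) x)" .
  have "(\<Sum>a\<in>UNIV. u a x * partial a (\<lambda>x. \<Sum>i\<in>I. f i x) x)
      = (\<Sum>a\<in>UNIV. \<Sum>i\<in>I. u a x * partial a (f i) x)"
    using assms by (simp add: partial_sum sum_distrib_left)
  also have "\<dots> = (\<Sum>i\<in>I. \<Sum>a\<in>UNIV. u a x * partial a (f i) x)"
    by (rule sum.swap)
  finally show "second_order u w (\<lambda>x. \<Sum>i\<in>I. f i x) x = (\<Sum>i\<in>I. second_order u w (f i) x)"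
    unfolding second_order_def 1 sum_distrib_left[of _ _ I] sum.distrib by (simp only:)
qed

lemma second_order_multi_op:
  assumes B: "\<And>\<beta>. smooth (B \<beta>)" and f: "smooth f"
  shows "second_order u w (multi_op q B f) x = (\<Sum>\<beta> | size \<beta> \<le> q.
      B \<beta> x * second_order u w (mpartial \<beta> f) x
      - (\<Sum>a\<in>UNIV. partial a (B \<beta>) x * mpartial (add_mset a \<beta>) f x)
      + second_order u (\<lambda>_. 0) (B \<beta>) x * mpartial \<beta> f x)"
  using assms
  by (simp add: multi_op_def second_order_sum finite_multisets_size_le smooth_mult smooth_mpartial
      second_order_mult mpartial_add_mset)

text \<open>At a point where the derivatives of \<open>f\<close> up to order \<open>\<bar>\<beta>\<bar>\<close> vanish, derivatives of the
  coefficients \<open>u\<close> and \<open>w\<close> cannot contribute.\<close>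

lemma mpartial_second_order_flat:
  assumes u: "\<And>a. smooth (u a)" and w: "smooth w" and f: "smooth f"
    and flat: "\<And>\<delta>. size \<delta> \<le> size \<beta> \<Longrightarrow> mpartial \<delta> f z = 0"
  shows "mpartial \<beta> (second_order u w f) z = second_order u w (mpartial \<beta> f) z"
proof -
  obtain as where as: "mset as = \<beta>" "\<And>f. mpartial \<beta> f = partials as f"
    using mpartial_partials by blast
  have len: "length as = size \<beta>"
    using as(1) by auto
  have flat': "partials bs f z = 0" if "length bs \<le> length as" for bs
    using flat[of "mset bs"] that len by (simp add: mpartial_mset f)
  have 1: "partials as (\<lambda>x. u a x * partial a f x) z = u a z * partial a (partials as f) z" for a
  proof -
    have "partials bs (partial a f) z = 0" if "length bs < length as" for bs
      using flat'[of "bs @ [a]"] that by (simp add: partials_append)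
    then have "partials as (\<lambda>x. u a x * partial a f x) z = u a z * partials as (partial a f) z"
      by (intro partials_mult_flat u smooth_partial f)
    then show ?thesis
      by (simp add: partials_partial_commute f)
  qed
  have 2: "partials as (\<lambda>x. w x * f x) z = w z * partials as f z"
    by (intro partials_mult_flat w f flat') simp
  have 3: "partials as (partial a (partial a f)) z = partial a (partial a (partials as f)) z" for a
    by (simp add: partials_partial_commute f smooth_partial)
  have "partials as (second_order u w f) z
      = - (1 / 2) * (\<Sum>a\<in>UNIV. partials as (partial a (partial a f)) z)
        + (\<Sum>a\<in>UNIV. partials as (\<lambda>x. u a x * partial a f x) z) + partials as (\<lambda>x. w x * f x) z"
    unfolding second_order_def
    by (simp only: partials_add partials_cmult partials_sum smooth_intros u w f)
  then show ?thesis
    unfolding as(2) 1 2 3 by (simp add: second_order_def)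
qed

text \<open>The commutator is tested on the monomial \<open>(x - z)\<^bsup>\<gamma>\<^esup>\<close> with \<open>\<bar>\<gamma>\<bar> = q + 1\<close> at the point \<open>z\<close>.
  All derivatives of order at most \<open>q\<close> vanish there, and what is left of \<open>[H, Q]\<close> is the mixed
  term of the Laplacian, \<open>-\<Sum>\<^sub>a \<partial>\<^sub>a B\<^bsub>\<gamma> - e\<^sub>a\<^esub> \<gamma>!\<close>.\<close>

lemma killing_equation:
  assumes u: "\<And>a. smooth (u a)" and w: "smooth w"
    and H: "\<And>f. smooth f \<Longrightarrow> H f = second_order u w f"
    and Q: "Q \<in> symmetry_ops q H" and \<gamma>: "size \<gamma> = Suc q"
  shows "(\<Sum>a\<in>UNIV. of_nat (count \<gamma> a) * partial a (symb Q (\<gamma> - {#a#})) z) = 0"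
proof -
  have Q': "Q \<in> diff_ops q"
    using Q by (simp add: symmetry_ops_def)
  obtain B where B: "Q = multi_op q B" "\<And>\<beta>. smooth (B \<beta>)"
    using Q' unfolding diff_ops_eq_multi_op by blast
  let ?f = "mon z \<gamma>"
  have smooth_Hf: "smooth (second_order u w ?f)"
    by (intro smooth_second_order u w smooth_mon)
  have flat: "mpartial \<delta> ?f z = 0" if "size \<delta> \<le> q" for \<delta>
    using that \<gamma> by (auto simp: mpartial_mon_center)
  have "second_order u w (Q ?f) z = Q (second_order u w ?f) z"
    using Q H by (simp add: symmetry_ops_def smooth_mon B smooth_multi_op)
  moreover have "second_order u w (Q ?f) z = (\<Sum>\<beta> | size \<beta> \<le> q.
      B \<beta> z * second_order u w (mpartial \<beta> ?f) z
      - (\<Sum>a\<in>UNIV. partial a (B \<beta>) z * mpartial (add_mset a \<beta>) ?f z))"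
    unfolding B(1) by (auto simp: second_order_multi_op B(2) smooth_mon flat intro!: sum.cong)
  moreover have "Q (second_order u w ?f) z
      = (\<Sum>\<beta> | size \<beta> \<le> q. B \<beta> z * second_order u w (mpartial \<beta> ?f) z)"
    using smooth_Hf unfolding B(1) multi_op_def
    by (auto simp: mpartial_second_order_flat[OF u w smooth_mon flat] intro!: sum.cong)
  ultimately have "0 = (\<Sum>\<beta> | size \<beta> \<le> q. \<Sum>a\<in>UNIV. partial a (B \<beta>) z * mpartial (add_mset a \<beta>) ?f z)"
    by (simp add: sum_subtractf)
  also have "\<dots> = (\<Sum>a\<in>UNIV. \<Sum>\<beta> | size \<beta> \<le> q. partial a (B \<beta>) z * mpartial (add_mset a \<beta>) ?f z)"
    by (rule sum.swap)
  also have "\<dots> = (\<Sum>a\<in>UNIV. of_nat (count \<gamma> a) * partial a (symb Q (\<gamma> - {#a#})) z)"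
  proof (rule sum.cong[OF refl])
    fix a
    show "(\<Sum>\<beta> | size \<beta> \<le> q. partial a (B \<beta>) z * mpartial (add_mset a \<beta>) ?f z)
        = of_nat (count \<gamma> a) * partial a (symb Q (\<gamma> - {#a#})) z"
    proof (cases "a \<in># \<gamma>")
      case True
      then obtain \<beta>' where \<beta>': "\<gamma> = add_mset a \<beta>'"
        by (blast dest: multi_member_split)
      have "(\<Sum>\<beta> | size \<beta> \<le> q. partial a (B \<beta>) z * mpartial (add_mset a \<beta>) ?f z)
          = (\<Sum>\<beta> | size \<beta> \<le> q. if \<beta> = \<beta>' then partial a (B \<beta>') z * of_nat (mfact \<gamma>) else 0)"
        by (auto simp: mpartial_mon_center \<beta>' intro!: sum.cong)
      also have "\<dots> = partial a (B \<beta>') z * of_nat (mfact \<gamma>)"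
        using \<gamma> by (simp add: finite_multisets_size_le \<beta>')
      also have "\<dots> = of_nat (count \<gamma> a) * partial a (symb Q (\<gamma> - {#a#})) z"
        using \<gamma> unfolding B(1) symb_multi_op
        by (simp add: \<beta>' mfact_add_mset partial_mult smooth_differentiable smooth_const B(2)
            algebra_simps)
      finally show ?thesis .
    next
      case False
      then have "mpartial (add_mset a \<beta>) ?f z = 0" for \<beta>
        by (auto simp: mpartial_mon_center)
      with False show ?thesis
        by (simp add: not_in_iff)
    qed
  qed
  finally show ?thesis
    by simp
qed

section \<open>Dimension of the symmetry space\<close>

lemma subspace_symmetry_ops:
  assumes u: "\<And>a. smooth (u a)" and w: "smooth w"
    and H: "\<And>f. smooth f \<Longrightarrow> H f = second_order u w f"
  shows "op_space.subspace (symmetry_ops q H)"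
proof (rule op_space.subspaceI)
  have lin: "second_order u w (\<lambda>x. f x + r * g x) = (\<lambda>x. second_order u w f x + r * second_order u w g x)"
    if "smooth f" "smooth g" for f g r
  proof -
    have p: "partials as (\<lambda>x. f x + r * g x) = (\<lambda>x. partials as f x + r * partials as g x)" for as
      by (simp add: partials_add partials_cmult smooth_mult smooth_const that)
    have "(\<Sum>a\<in>UNIV. partial a (partial a (\<lambda>x. f x + r * g x)) x)
        = (\<Sum>a\<in>UNIV. partial a (partial a f) x) + r * (\<Sum>a\<in>UNIV. partial a (partial a g) x)" for x
      using p[of "[a, a]" for a] by (simp add: sum.distrib sum_distrib_left)
    moreover have "(\<Sum>a\<in>UNIV. u a x * partial a (\<lambda>x. f x + r * g x) x)
        = (\<Sum>a\<in>UNIV. u a x * partial a f x) + r * (\<Sum>a\<in>UNIV. u a x * partial a g x)" for x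
      using p[of "[a]" for a] by (simp add: sum.distrib sum_distrib_left algebra_simps)
    ultimately show ?thesis
      by (simp add: second_order_def algebra_simps)
  qed
  have comb: "(\<lambda>f x. P f x + r * Q f x) \<in> symmetry_ops q H"
    if P: "P \<in> symmetry_ops q H" and Q: "Q \<in> symmetry_ops q H" for P Q r
  proof -
    obtain B where B: "P = multi_op q B" "\<And>\<beta>. smooth (B \<beta>)"
      using P unfolding symmetry_ops_def diff_ops_eq_multi_op by auto
    obtain C where C: "Q = multi_op q C" "\<And>\<beta>. smooth (C \<beta>)"
      using Q unfolding symmetry_ops_def diff_ops_eq_multi_op by auto
    have "(\<lambda>f x. P f x + r * Q f x) = multi_op q (\<lambda>\<beta> x. B \<beta> x + r * C \<beta> x)"
      unfolding B C by (auto simp: multi_op_def fun_eq_iff sum.distrib sum_distrib_left algebra_simps)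
    moreover have "smooth (\<lambda>x. B \<beta> x + r * C \<beta> x)" for \<beta>
      by (intro smooth_intros B C)
    ultimately have "(\<lambda>f x. P f x + r * Q f x) \<in> diff_ops q"
      unfolding diff_ops_eq_multi_op by auto
    moreover have "H (\<lambda>x. P f x + r * Q f x) = (\<lambda>x. P (H f) x + r * Q (H f) x)" if f: "smooth f" for f
    proof -
      have smooth: "smooth (P f)" "smooth (Q f)"
        unfolding B(1) C(1) by (intro smooth_multi_op B C)+
      then have "H (\<lambda>x. P f x + r * Q f x) = (\<lambda>x. H (P f) x + r * H (Q f) x)"
        by (simp add: H lin smooth_intros)
      then show ?thesis
        using P Q f by (simp add: symmetry_ops_def)
    qed
    ultimately show ?thesis
      by (simp add: symmetry_ops_def)
  qed
  have "(\<lambda>_ _. 0) = multi_op q (\<lambda>_ _. 0)"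
    by (auto simp: multi_op_def fun_eq_iff)
  then have "(\<lambda>_ _. 0) \<in> diff_ops q"
    unfolding diff_ops_eq_multi_op by (auto intro: smooth_const)
  moreover have "H (\<lambda>_. 0) = (\<lambda>_. 0)"
    by (simp add: H smooth_const second_order_def)
  ultimately show zero: "0 \<in> symmetry_ops q H"
    by (simp add: symmetry_ops_def zero_fun_def)
  show "P + Q \<in> symmetry_ops q H" if "P \<in> symmetry_ops q H" "Q \<in> symmetry_ops q H" for P Q
    using comb[OF that, of 1] by (simp add: plus_fun_def)
  show "scale_op r Q \<in> symmetry_ops q H" if "Q \<in> symmetry_ops q H" for r Q
    using comb[OF zero that, of r] by (simp add: scale_op_def)
qed

lemma symb_linear:
  "symb (P + Q) \<beta> = (\<lambda>z. symb P \<beta> z + symb Q \<beta> z)"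
  "symb (scale_op r Q) \<beta> = (\<lambda>z. r * symb Q \<beta> z)"
  by (simp_all add: symb_def scale_op_def)

text \<open>The derivatives at \<open>z\<close> of the leading coefficients only. The lower coefficients are set to zero,
  because only the leading ones have to satisfy the Killing equation.\<close>

definition symbol_jet :: "nat \<Rightarrow> real^'n \<Rightarrow> 'n::finite operator \<Rightarrow> 'n multiset \<times> 'n multiset \<Rightarrow> complex" where
  "symbol_jet q z Q = (\<lambda>(\<alpha>, \<beta>). if size \<beta> = q then mpartial \<alpha> (symb Q \<beta>) z else 0)"

lemma symbol_jet_linear:
  assumes "P \<in> diff_ops q" and "Q \<in> diff_ops q"
  shows "symbol_jet q z (P + Q) = symbol_jet q z P + symbol_jet q z Q"
    and "symbol_jet q z (scale_op r Q) = scale_coeff r (symbol_jet q z Q)"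
proof -
  have "mpartial \<alpha> (symb (P + Q) \<beta>) z = mpartial \<alpha> (symb P \<beta>) z + mpartial \<alpha> (symb Q \<beta>) z" for \<alpha> \<beta>
    unfolding mpartial_def symb_linear by (subst partials_add) (auto intro: smooth_symb assms)
  then show "symbol_jet q z (P + Q) = symbol_jet q z P + symbol_jet q z Q"
    by (auto simp: symbol_jet_def fun_eq_iff)
  have "mpartial \<alpha> (symb (scale_op r Q) \<beta>) z = r * mpartial \<alpha> (symb Q \<beta>) z" for \<alpha> \<beta>
    unfolding mpartial_def symb_linear by (subst partials_cmult) (auto intro: smooth_symb assms)
  then show "symbol_jet q z (scale_op r Q) = scale_coeff r (symbol_jet q z Q)"
    by (auto simp: symbol_jet_def scale_coeff_def fun_eq_iff)
qed

text \<open>The equation \<open>p_dx c = 0\<close> at \<open>(\<alpha>, \<gamma>)\<close> is the derivative of multi-index \<open>\<alpha>\<close> of the Killing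
  equation at \<open>\<gamma>\<close>.\<close>

lemma p_dx_symbol_jet:
  assumes u: "\<And>a. smooth (u a)" and w: "smooth w"
    and H: "\<And>f. smooth f \<Longrightarrow> H f = second_order u w f"
    and Q: "Q \<in> symmetry_ops q H"
  shows "p_dx (symbol_jet q z Q) = 0"
proof -
  have sm: "smooth (symb Q \<beta>)" for \<beta>
    using Q smooth_symb by (auto simp: symmetry_ops_def)
  have "p_dx (symbol_jet q z Q) (\<alpha>, \<gamma>) = 0" for \<alpha> \<gamma>
  proof (cases "size \<gamma> = Suc q")
    case True
    obtain as where as: "\<And>f. mpartial \<alpha> f = partials as f"
      using mpartial_partials by blast
    have "of_nat (count \<gamma> a) * symbol_jet q z Q (add_mset a \<alpha>, \<gamma> - {#a#})
        = of_nat (count \<gamma> a) * partials as (partial a (symb Q (\<gamma> - {#a#}))) z" for a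
    proof (cases "a \<in># \<gamma>")
      case a: True
      then have "size (\<gamma> - {#a#}) = q"
        using True by (simp add: size_Diff_singleton)
      then show ?thesis
        by (simp add: symbol_jet_def mpartial_partial[symmetric] sm as)
    qed (simp add: not_in_iff)
    then have "p_dx (symbol_jet q z Q) (\<alpha>, \<gamma>)
        = (\<Sum>a\<in>UNIV. of_nat (count \<gamma> a) * partials as (partial a (symb Q (\<gamma> - {#a#}))) z)"
      unfolding p_dx_def prod.case by (rule sum.cong[OF refl])
    also have "\<dots> = partials as
        (\<lambda>z. \<Sum>a\<in>UNIV. of_nat (count \<gamma> a) * partial a (symb Q (\<gamma> - {#a#})) z) z"
      by (simp only: partials_sum partials_cmult smooth_partial sm smooth_mult smooth_const)
    also have "\<dots> = 0"
      by (simp only: killing_equation[OF u w H Q True] partials_zero)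
    finally show ?thesis .
  next
    case False
    then have "of_nat (count \<gamma> a) * symbol_jet q z Q (add_mset a \<alpha>, \<gamma> - {#a#}) = 0" for a
      by (cases "a \<in># \<gamma>") (auto simp: symbol_jet_def not_in_iff dest!: multi_member_split)
    then show ?thesis
      by (simp only: p_dx_def prod.case sum.neutral_const)
  qed
  then show ?thesis
    by (auto simp: fun_eq_iff)
qed

lemma symbol_jet_bounded:
  assumes u: "\<And>a. smooth (u a)" and w: "smooth w"
    and H: "\<And>f. smooth f \<Longrightarrow> H f = second_order u w f"
    and Q: "Q \<in> symmetry_ops q H" and \<alpha>: "size \<alpha> > q"
  shows "symbol_jet q z Q (\<alpha>, \<beta>) = 0"
proof (cases "size \<beta> = q")
  case True
  show ?thesis
  proof (rule negative_weight_eq_zero[where k = q])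
    show "p_dx (symbol_jet q z Q) = 0"
      using assms by (intro p_dx_symbol_jet)
    show "size (snd i) \<le> q" if "symbol_jet q z Q i \<noteq> 0" for i
      using that by (auto simp: symbol_jet_def split: prod.splits if_splits)
    show "weight (\<alpha>, \<beta>) < 0"
      using True \<alpha> by simp
  qed
qed (simp add: symbol_jet_def)

text \<open>The derivatives of order \<open>q + 1\<close> of the leading coefficients vanish everywhere, because the jets at
  all points, and not only at the origin, are annihilated by \<open>p_dx\<close>.\<close>

lemma symb_eq_zero_if_symbol_jet_eq_zero:
  assumes u: "\<And>a. smooth (u a)" and w: "smooth w"
    and H: "\<And>f. smooth f \<Longrightarrow> H f = second_order u w f"
    and Q: "Q \<in> symmetry_ops q H" and zero: "symbol_jet q 0 Q = 0" and \<beta>: "size \<beta> = q"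
  shows "symb Q \<beta> = (\<lambda>_. 0)"
proof (rule zero_if_jet_zero[where q = q])
  show "smooth (symb Q \<beta>)"
    using Q smooth_symb by (auto simp: symmetry_ops_def)
  show "mpartial \<alpha> (symb Q \<beta>) = (\<lambda>_. 0)" if "size \<alpha> = Suc q" for \<alpha>
    using symbol_jet_bounded[OF u w H Q, of \<alpha> _ \<beta>] that \<beta> by (auto simp: symbol_jet_def)
  show "mpartial \<alpha> (symb Q \<beta>) 0 = 0" for \<alpha>
    using fun_cong[OF zero, of "(\<alpha>, \<beta>)"] \<beta> by (simp add: symbol_jet_def)
qed

lemma symbol_jet_image:
  assumes u: "\<And>a. smooth (u a)" and w: "smooth w"
    and H: "\<And>f. smooth f \<Longrightarrow> H f = second_order u w f"
  shows "symbol_jet q 0 ` symmetry_ops q H \<subseteq> {c \<in> supported (killing_jets q). p_dx c = 0}"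
proof safe
  fix Q assume Q: "Q \<in> symmetry_ops q H"
  show "p_dx (symbol_jet q 0 Q) = 0"
    by (rule p_dx_symbol_jet[OF u w H Q])
  have "symbol_jet q 0 Q (\<alpha>, \<beta>) = 0" if "(\<alpha>, \<beta>) \<notin> killing_jets q" for \<alpha> \<beta>
    using that symbol_jet_bounded[OF u w H Q, of \<alpha> 0 \<beta>]
    by (cases "size \<alpha> \<le> q") (auto simp: symbol_jet_def killing_jets_def)
  then show "symbol_jet q 0 Q \<in> supported (killing_jets q)"
    by (auto simp: supported_def)
qed

text \<open>Induction on \<open>q\<close> along the map that sends an operator to the jet of its leading coefficients at
  the origin. The kernel consists of symmetry operators of order less than \<open>q\<close>, and the image
  of jets of Killing tensors.\<close>

lemma symmetry_ops_dim_le: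
  fixes H :: "'n::finite operator"
  assumes u: "\<And>a. smooth (u a)" and w: "smooth w"
    and H: "\<And>f. smooth f \<Longrightarrow> H f = second_order u w f"
  shows "(\<exists>B. finite B \<and> symmetry_ops q H \<subseteq> op_space.span B)
    \<and> real (op_space.dim (symmetry_ops q H)) \<le> N_tilde CARD('n) q"
proof -
  have step: "(\<exists>B. finite B \<and> symmetry_ops q H \<subseteq> op_space.span B)
      \<and> real (op_space.dim (symmetry_ops q H))
        \<le> real (op_space.dim {Q \<in> symmetry_ops q H. symbol_jet q 0 Q = 0}) + K_term CARD('n) q"
    if ker: "{Q \<in> symmetry_ops q H. symbol_jet q 0 Q = 0} \<subseteq> op_space.span B" "finite B" for q B
  proof -
    let ?I = "killing_jets q :: ('n multiset \<times> 'n multiset) set"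
    let ?K = "{c \<in> supported ?I. p_dx c = 0}"
    have diff: "Q \<in> diff_ops q" if "Q \<in> symmetry_ops q H" for Q
      using that by (simp add: symmetry_ops_def)
    have K: "?K \<subseteq> coeff_space.span (unit_coeff ` ?I)"
      using supported_in_span[OF finite_killing_jets] by auto
    have image: "symbol_jet q 0 ` symmetry_ops q H \<subseteq> ?K"
      by (rule symbol_jet_image[OF u w H])
    have "coeff_space.dim (symbol_jet q 0 ` symmetry_ops q H) \<le> coeff_space.dim ?K"
      by (rule coeff_space.dim_mono_of_finite[OF image K]) (simp add: finite_killing_jets)
    moreover have "real (coeff_space.dim ?K) \<le> K_term CARD('n) q"
      by (rule dim_killing_jets_le)
    moreover have "(\<exists>B. finite B \<and> symmetry_ops q H \<subseteq> op_space.span B)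
      \<and> op_space.dim (symmetry_ops q H) = op_space.dim {Q \<in> symmetry_ops q H. symbol_jet q 0 Q = 0}
        + coeff_space.dim (symbol_jet q 0 ` symmetry_ops q H)"
      using op_coeff.rank_nullity_on[OF subspace_symmetry_ops[OF u w H] symbol_jet_linear(1)[OF diff diff]
          symbol_jet_linear(2)[OF diff diff] ker order_trans[OF image K]]
      by (simp add: finite_killing_jets)
    ultimately show ?thesis
      by simp
  qed
  show ?thesis
  proof (induction q)
    case 0
    have "Q = 0" if Q: "Q \<in> symmetry_ops 0 H" "symbol_jet 0 0 Q = 0" for Q
    proof -
      have "Q = multi_op 0 (\<lambda>\<beta> z. symb Q \<beta> z / of_nat (mfact \<beta>))"
        using Q(1) by (intro diff_ops_symb_eq) (simp add: symmetry_ops_def)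
      also have "\<dots> = 0"
        using symb_eq_zero_if_symbol_jet_eq_zero[OF u w H Q, of "{#}"]
        by (auto simp: multi_op_def fun_eq_iff)
      finally show ?thesis .
    qed
    then have ker: "{Q \<in> symmetry_ops 0 H. symbol_jet 0 0 Q = 0} \<subseteq> op_space.span {}"
      by auto
    then have "op_space.dim {Q \<in> symmetry_ops 0 H. symbol_jet 0 0 Q = 0} = 0"
      using op_space.dim_le_card[OF ker] by simp
    then show ?case
      using step[OF ker] by (simp add: N_tilde_def)
  next
    case (Suc q)
    have "Q \<in> symmetry_ops q H" if Q: "Q \<in> symmetry_ops (Suc q) H" "symbol_jet (Suc q) 0 Q = 0" for Q
    proof -
      define B where "B = (\<lambda>\<beta> z. symb Q \<beta> z / of_nat (mfact \<beta>))"
      have "Q \<in> diff_ops (Suc q)"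
        using Q(1) by (simp add: symmetry_ops_def)
      then have B: "Q = multi_op (Suc q) B" and "\<And>\<beta>. smooth (\<lambda>z. inverse (of_nat (mfact \<beta>)) * symb Q \<beta> z)"
        unfolding B_def by (auto intro: diff_ops_symb_eq smooth_mult smooth_const smooth_symb)
      then have smooth_B: "smooth (B \<beta>)" for \<beta>
        by (simp add: B_def field_class.field_divide_inverse mult.commute)
      have "B \<beta> = (\<lambda>_. 0)" if "size \<beta> = Suc q" for \<beta>
        using symb_eq_zero_if_symbol_jet_eq_zero[OF u w H Q that] by (simp add: B_def)
      then have "(\<Sum>\<beta> | size \<beta> \<le> Suc q. B \<beta> x * mpartial \<beta> f x)
          = (\<Sum>\<beta> | size \<beta> \<le> q. B \<beta> x * mpartial \<beta> f x)" for f x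
        by (intro sum.mono_neutral_right finite_multisets_size_le) (auto simp: le_Suc_eq)
      then have "Q = multi_op q B"
          unfolding B multi_op_def by (simp only:)
      then have "Q \<in> diff_ops q"
        unfolding diff_ops_eq_multi_op using smooth_B by auto
      then show ?thesis
        using Q(1) by (simp add: symmetry_ops_def)
    qed
    then have sub: "{Q \<in> symmetry_ops (Suc q) H. symbol_jet (Suc q) 0 Q = 0} \<subseteq> symmetry_ops q H"
      by auto
    obtain B where B: "finite B" "symmetry_ops q H \<subseteq> op_space.span B"
      using Suc.IH by auto
    have "op_space.dim {Q \<in> symmetry_ops (Suc q) H. symbol_jet (Suc q) 0 Q = 0}
        \<le> op_space.dim (symmetry_ops q H)"
      by (rule op_space.dim_mono_of_finite[OF sub B(2,1)])
    then show ?case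
      using step[OF order_trans[OF sub B(2)] B(1)] Suc.IH by (simp add: N_tilde_def)
  qed
qed

section \<open>Symmetries of the free Hamiltonian\<close>

lemma sum_multisets_add_mset:
  fixes g :: "'n::finite multiset \<Rightarrow> complex"
  assumes "\<And>\<alpha>. a \<notin># \<alpha> \<Longrightarrow> g \<alpha> = 0"
  shows "(\<Sum>\<alpha> | size \<alpha> \<le> Suc q. g \<alpha>) = (\<Sum>\<alpha> | size \<alpha> \<le> q. g (add_mset a \<alpha>))"
proof -
  have "(\<Sum>\<alpha> | size \<alpha> \<le> q. g (add_mset a \<alpha>)) = (\<Sum>\<alpha>\<in>add_mset a ` {\<alpha>. size \<alpha> \<le> q}. g \<alpha>)"
    by (subst sum.reindex) (auto simp: inj_on_def)
  also have "\<dots> = (\<Sum>\<alpha> | size \<alpha> \<le> Suc q. g \<alpha>)"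
  proof (intro sum.mono_neutral_left finite_multisets_size_le ballI)
    fix \<alpha> :: "'n multiset"
    assume \<alpha>: "\<alpha> \<in> {\<alpha>. size \<alpha> \<le> Suc q} - add_mset a ` {\<alpha>. size \<alpha> \<le> q}"
    then have "a \<notin># \<alpha>"
      by (auto dest!: multi_member_split)
    then show "g \<alpha> = 0"
      by (rule assms)
  qed auto
  finally show ?thesis ..
qed

text \<open>The Taylor polynomial with the derivatives \<open>d\<close> at the origin.\<close>

definition jet_poly :: "nat \<Rightarrow> ('n::finite multiset \<Rightarrow> complex) \<Rightarrow> real^'n \<Rightarrow> complex" where
  "jet_poly q d = (\<lambda>x. \<Sum>\<alpha> | size \<alpha> \<le> q. d \<alpha> / of_nat (mfact \<alpha>) * mon 0 \<alpha> x)"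

lemma smooth_jet_poly: "smooth (jet_poly q d)"
  unfolding jet_poly_def by (intro smooth_intros smooth_mon)

lemma jet_poly_zero: "jet_poly q (\<lambda>_. 0) = (\<lambda>_. 0)"
  by (simp add: jet_poly_def)

lemma jet_poly_add: "jet_poly q (\<lambda>\<alpha>. d \<alpha> + d' \<alpha>) x = jet_poly q d x + jet_poly q d' x"
  by (simp add: jet_poly_def sum.distrib add_divide_distrib distrib_right)

lemma jet_poly_cmult: "jet_poly q (\<lambda>\<alpha>. r * d \<alpha>) x = r * jet_poly q d x"
  by (simp add: jet_poly_def sum_distrib_left mult.assoc)

lemma jet_poly_sum: "jet_poly q (\<lambda>\<alpha>. \<Sum>i\<in>I. d i \<alpha>) x = (\<Sum>i\<in>I. jet_poly q (d i) x)"
  by (induction I rule: infinite_finite_induct) (simp_all add: jet_poly_zero jet_poly_add)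

lemma mpartial_jet_poly:
  assumes "size \<alpha> \<le> q"
  shows "mpartial \<alpha> (jet_poly q d) 0 = d \<alpha>"
proof -
  obtain as where as: "\<And>f. mpartial \<alpha> f = partials as f"
    using mpartial_partials by blast
  have "mpartial \<alpha> (jet_poly q d) 0 = (\<Sum>\<beta> | size \<beta> \<le> q. d \<beta> / of_nat (mfact \<beta>) * mpartial \<alpha> (mon 0 \<beta>) 0)"
    unfolding as jet_poly_def
    by (simp only: partials_sum partials_cmult smooth_mult smooth_const smooth_mon)
  also have "\<dots> = (\<Sum>\<beta> | size \<beta> \<le> q. if \<alpha> = \<beta> then d \<alpha> else 0)"
    by (intro sum.cong) (auto simp: mpartial_mon_center mfact_pos)
  also have "\<dots> = d \<alpha>"
    using assms by (simp add: finite_multisets_size_le)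
  finally show ?thesis .
qed

lemma partial_jet_poly:
  assumes d: "\<And>\<alpha>. size \<alpha> > q \<Longrightarrow> d \<alpha> = 0"
  shows "partial a (jet_poly q d) = jet_poly q (\<lambda>\<alpha>. d (add_mset a \<alpha>))"
proof
  fix x
  let ?g = "\<lambda>\<alpha>. d \<alpha> / of_nat (mfact \<alpha>) * (of_nat (count \<alpha> a) * mon 0 (\<alpha> - {#a#}) x)"
  have "partials [a] (jet_poly q d) x
      = (\<Sum>\<alpha> | size \<alpha> \<le> q. d \<alpha> / of_nat (mfact \<alpha>) * partials [a] (mon 0 \<alpha>) x)"
    unfolding jet_poly_def
    by (simp only: partials_sum partials_cmult smooth_mult smooth_const smooth_mon)
  then have "partial a (jet_poly q d) x = (\<Sum>\<alpha> | size \<alpha> \<le> q. ?g \<alpha>)"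
    by (simp only: partials_Cons partials_Nil partial_mon)
  also have "\<dots> = (\<Sum>\<alpha> | size \<alpha> \<le> Suc q. ?g \<alpha>)"
    by (intro sum.mono_neutral_left finite_multisets_size_le) (auto simp: d)
  also have "\<dots> = (\<Sum>\<alpha> | size \<alpha> \<le> q. ?g (add_mset a \<alpha>))"
    by (rule sum_multisets_add_mset) (simp add: not_in_iff)
  also have "\<dots> = jet_poly q (\<lambda>\<alpha>. d (add_mset a \<alpha>)) x"
    unfolding jet_poly_def
    by (intro sum.cong refl) (simp add: mfact_add_mset del: of_nat_Suc mult_Suc)
  finally show "partial a (jet_poly q d) x = jet_poly q (\<lambda>\<alpha>. d (add_mset a \<alpha>)) x" .
qed

text \<open>The operator whose symbol has the jet \<open>c\<close>.\<close>

definition jet_op :: "nat \<Rightarrow> ('n::finite multiset \<times> 'n multiset \<Rightarrow> complex) \<Rightarrow> 'n operator" where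
  "jet_op q c = multi_op q (\<lambda>\<beta> x. inverse (of_nat (mfact \<beta>)) * jet_poly q (\<lambda>\<alpha>. c (\<alpha>, \<beta>)) x)"

lemma jet_op_linear:
  "jet_op q (c + d) = jet_op q c + jet_op q d"
  "jet_op q (scale_coeff r c) = scale_op r (jet_op q c)"
  by (auto simp: jet_op_def multi_op_def fun_eq_iff jet_poly_add jet_poly_cmult scale_coeff_def
      scale_op_def sum.distrib sum_distrib_left algebra_simps)

lemma jet_op_diff_ops: "jet_op q c \<in> diff_ops q"
proof -
  have "smooth (\<lambda>x. inverse (of_nat (mfact \<beta>)) * jet_poly q (\<lambda>\<alpha>. c (\<alpha>, \<beta>)) x)" for \<beta>
    by (intro smooth_mult smooth_const smooth_jet_poly)
  then show ?thesis
    unfolding jet_op_def diff_ops_eq_multi_op by auto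
qed

lemma jet_op_eq_zero:
  assumes c: "c \<in> supported (free_jets q)" and zero: "jet_op q c = 0"
  shows "c = 0"
proof -
  have "c (\<alpha>, \<beta>) = 0" for \<alpha> \<beta>
  proof (cases "(\<alpha>, \<beta>) \<in> free_jets q")
    case True
    then have size: "size \<alpha> \<le> q" "size \<beta> \<le> q"
      by (auto simp: free_jets_def)
    have "symb (jet_op q c) \<beta> = jet_poly q (\<lambda>\<alpha>. c (\<alpha>, \<beta>))"
      using size mfact_pos[of \<beta>] by (simp add: jet_op_def symb_multi_op flip: mult.assoc)
    then have "jet_poly q (\<lambda>\<alpha>. c (\<alpha>, \<beta>)) = (\<lambda>_. 0)"
      using zero by (simp add: symb_def)
    then show ?thesis
      using mpartial_jet_poly[OF size(1), of "\<lambda>\<alpha>. c (\<alpha>, \<beta>)"]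
        mpartial_jet_poly[OF size(1), of "\<lambda>_. 0"] by (simp add: jet_poly_zero)
  qed (use c in \<open>auto simp: supported_def\<close>)
  then show ?thesis
    by (auto simp: fun_eq_iff)
qed

abbreviation free_second_order :: "'n::finite operator" where
  "free_second_order \<equiv> second_order (\<lambda>_ _. 0) (\<lambda>_. 0)"

lemma mpartial_free_second_order:
  assumes f: "smooth f"
  shows "mpartial \<beta> (free_second_order f) = free_second_order (mpartial \<beta> f)"
proof -
  obtain as where as: "\<And>f. mpartial \<beta> f = partials as f"
    using mpartial_partials by blast
  have "partials as (\<lambda>x. - (1 / 2) * (\<Sum>a\<in>UNIV. partial a (partial a f) x))
      = (\<lambda>x. - (1 / 2) * (\<Sum>a\<in>UNIV. partials as (partial a (partial a f)) x))"
    by (simp only: partials_sum partials_cmult smooth_sum smooth_partial f)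
  then show ?thesis
    unfolding as second_order_def by (simp add: partials_partial_commute f smooth_partial)
qed

text \<open>The commutator of \<open>-\<Delta>/2\<close> with \<open>Q = \<Sum>\<^sub>\<beta> B\<^sub>\<beta> \<partial>\<^bsup>\<beta>\<^esup>\<close> consists of the Laplacians of the
  coefficients and of the mixed terms \<open>\<partial>\<^sub>a B\<^sub>\<beta> \<partial>\<^bsup>\<beta> + e\<^sub>a\<^esup>\<close>. Sorted by the multi-index \<open>\<gamma>\<close> of the
  derivative, the coefficient is \<open>-1 / (2 \<gamma>!)\<close> times the Taylor polynomial of \<open>free_op c\<close>.\<close>

lemma jet_op_commutes:
  assumes c: "c \<in> supported (free_jets q)" and zero: "free_op c = 0" and f: "smooth f"
  shows "free_second_order (jet_op q c f) = jet_op q c (free_second_order f)"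
proof
  fix x
  define k where "k \<beta> = jet_poly q (\<lambda>\<alpha>. c (\<alpha>, \<beta>))" for \<beta>
  define B where "B \<beta> = (\<lambda>x. inverse (of_nat (mfact \<beta>)) * k \<beta> x)" for \<beta>
  define g where "g \<beta> = mpartial \<beta> f x" for \<beta>
  have bound: "c (\<alpha>, \<beta>) = 0" if "size \<alpha> > q \<or> size \<beta> > q" for \<alpha> \<beta>
    using c that by (auto simp: supported_def free_jets_def)
  have smooth_k: "smooth (k \<beta>)" for \<beta>
    unfolding k_def by (rule smooth_jet_poly)
  have smooth_B: "smooth (B \<beta>)" for \<beta>
    unfolding B_def by (intro smooth_mult smooth_const smooth_k)
  have partial_B: "partial a (B \<beta>) = (\<lambda>x. inverse (of_nat (mfact \<beta>)) * partial a (k \<beta>) x)" for a \<beta>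
    using partials_cmult[OF smooth_k, of "[a]"] by (simp add: B_def)
  have partial_partial_B: "partial a (partial a (B \<beta>)) x = inverse (of_nat (mfact \<beta>)) * partial a (partial a (k \<beta>)) x"
    for a \<beta>
    unfolding partial_B using partials_cmult[OF smooth_partial[OF smooth_k], of "[a]"] by simp
  have smooth_Hf: "smooth (free_second_order f)"
    by (intro smooth_second_order smooth_const f)
  \<comment> \<open>the polynomial function with the vanishing jet \<open>free_op c\<close>\<close>
  have equation: "(\<Sum>a\<in>UNIV. partial a (partial a (k \<gamma>)) x)
      + 2 * (\<Sum>a\<in>UNIV. of_nat (count \<gamma> a) * partial a (k (\<gamma> - {#a#})) x) = 0" for \<gamma>
  proof -
    have "(\<Sum>a\<in>UNIV. partial a (partial a (k \<gamma>)) x)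
      + 2 * (\<Sum>a\<in>UNIV. of_nat (count \<gamma> a) * partial a (k (\<gamma> - {#a#})) x)
      = jet_poly q (\<lambda>\<alpha>. free_op c (\<alpha>, \<gamma>)) x"
      unfolding k_def
      by (simp add: partial_jet_poly bound free_op_def p_dx_def jet_poly_add jet_poly_cmult jet_poly_sum)
    then show ?thesis
      by (simp add: zero jet_poly_zero)
  qed
  \<comment> \<open>substitute \<open>\<gamma> = \<beta> + e\<^sub>a\<close>; the factor \<open>\<gamma>\<^sub>a / \<gamma>! = 1 / \<beta>!\<close> appears\<close>
  have shift: "(\<Sum>\<beta> | size \<beta> \<le> q. partial a (B \<beta>) x * g (add_mset a \<beta>))
      = (\<Sum>\<gamma> | size \<gamma> \<le> Suc q. of_nat (count \<gamma> a) * partial a (k (\<gamma> - {#a#})) x * (g \<gamma> / of_nat (mfact \<gamma>)))" for a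
  proof -
    have cancel: "inverse m * k' * r = N * k' * (r / (N * m))" if "N \<noteq> 0" for N m k' r :: complex
      using that by (simp add: divide_inverse)
    have "(\<Sum>\<beta> | size \<beta> \<le> q. partial a (B \<beta>) x * g (add_mset a \<beta>))
        = (\<Sum>\<beta> | size \<beta> \<le> q. of_nat (count (add_mset a \<beta>) a)
          * partial a (k (add_mset a \<beta> - {#a#})) x * (g (add_mset a \<beta>) / of_nat (mfact (add_mset a \<beta>))))"
      unfolding partial_B mfact_add_mset of_nat_mult
      by (intro sum.cong refl) (subst cancel[of "of_nat (Suc (count \<beta> a))" for \<beta>], auto simp del: of_nat_Suc)
    also have "\<dots> = (\<Sum>\<gamma> | size \<gamma> \<le> Suc q. of_nat (count \<gamma> a) * partial a (k (\<gamma> - {#a#})) x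
        * (g \<gamma> / of_nat (mfact \<gamma>)))"
      by (rule sum_multisets_add_mset[symmetric]) (simp add: not_in_iff)
    finally show ?thesis .
  qed
  have "(\<Sum>\<beta> | size \<beta> \<le> q. \<Sum>a\<in>UNIV. partial a (B \<beta>) x * g (add_mset a \<beta>))
      = (\<Sum>a\<in>UNIV. \<Sum>\<beta> | size \<beta> \<le> q. partial a (B \<beta>) x * g (add_mset a \<beta>))"
    by (rule sum.swap)
  also have "\<dots> = (\<Sum>\<gamma> | size \<gamma> \<le> Suc q. \<Sum>a\<in>UNIV.
      of_nat (count \<gamma> a) * partial a (k (\<gamma> - {#a#})) x * (g \<gamma> / of_nat (mfact \<gamma>)))"
    unfolding shift by (rule sum.swap)
  finally have first: "(\<Sum>\<beta> | size \<beta> \<le> q. \<Sum>a\<in>UNIV. partial a (B \<beta>) x * g (add_mset a \<beta>))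
      = (\<Sum>\<gamma> | size \<gamma> \<le> Suc q.
        (\<Sum>a\<in>UNIV. of_nat (count \<gamma> a) * partial a (k (\<gamma> - {#a#})) x) * (g \<gamma> / of_nat (mfact \<gamma>)))"
    by (simp only: sum_distrib_right)
  have "(\<Sum>a\<in>UNIV. partial a (partial a (B \<beta>)) x)
      = inverse (of_nat (mfact \<beta>)) * (\<Sum>a\<in>UNIV. partial a (partial a (k \<beta>)) x)" for \<beta>
    by (simp only: partial_partial_B sum_distrib_left)
  then have "free_second_order (B \<beta>) x
      = - (1 / 2) * (inverse (of_nat (mfact \<beta>)) * (\<Sum>a\<in>UNIV. partial a (partial a (k \<beta>)) x))" for \<beta>
    by (simp only: second_order_def mult_zero_left sum.neutral_const add_0_right)
  then have "free_second_order (B \<beta>) x * g \<beta>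
      = - (1 / 2) * ((\<Sum>a\<in>UNIV. partial a (partial a (k \<beta>)) x) * (g \<beta> / of_nat (mfact \<beta>)))" for \<beta>
    by (simp only: divide_inverse mult_ac)
  then have "(\<Sum>\<beta> | size \<beta> \<le> q. free_second_order (B \<beta>) x * g \<beta>) = (\<Sum>\<beta> | size \<beta> \<le> q.
      - (1 / 2) * ((\<Sum>a\<in>UNIV. partial a (partial a (k \<beta>)) x) * (g \<beta> / of_nat (mfact \<beta>))))"
    by (simp only:)
  also have "\<dots> = (\<Sum>\<beta> | size \<beta> \<le> Suc q.
      - (1 / 2) * ((\<Sum>a\<in>UNIV. partial a (partial a (k \<beta>)) x) * (g \<beta> / of_nat (mfact \<beta>))))"
    by (intro sum.mono_neutral_left finite_multisets_size_le)
      (auto simp: k_def bound jet_poly_zero)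
  \<comment> \<open>the range is extended to order \<open>q + 1\<close>, where the coefficients vanish, to match the mixed terms\<close>
  finally have second: "(\<Sum>\<beta> | size \<beta> \<le> q. free_second_order (B \<beta>) x * g \<beta>)
      = (\<Sum>\<gamma> | size \<gamma> \<le> Suc q.
        - (1 / 2) * ((\<Sum>a\<in>UNIV. partial a (partial a (k \<gamma>)) x) * (g \<gamma> / of_nat (mfact \<gamma>))))" .
  have "(\<Sum>\<beta> | size \<beta> \<le> q. free_second_order (B \<beta>) x * g \<beta>)
      - (\<Sum>\<beta> | size \<beta> \<le> q. \<Sum>a\<in>UNIV. partial a (B \<beta>) x * g (add_mset a \<beta>))
    = (\<Sum>\<gamma> | size \<gamma> \<le> Suc q. - (1 / 2) * ((\<Sum>a\<in>UNIV. partial a (partial a (k \<gamma>)) x)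
        + 2 * (\<Sum>a\<in>UNIV. of_nat (count \<gamma> a) * partial a (k (\<gamma> - {#a#})) x)) * (g \<gamma> / of_nat (mfact \<gamma>)))"
    unfolding first second by (simp only: sum_subtractf[symmetric]) (simp add: algebra_simps)
  also have "\<dots> = 0"
    unfolding equation by simp
  finally have difference: "(\<Sum>\<beta> | size \<beta> \<le> q. free_second_order (B \<beta>) x * g \<beta>)
      - (\<Sum>\<beta> | size \<beta> \<le> q. \<Sum>a\<in>UNIV. partial a (B \<beta>) x * g (add_mset a \<beta>)) = 0" .
  have jet_op: "jet_op q c = multi_op q B"
    by (simp only: jet_op_def B_def[abs_def] k_def[abs_def])
  have "free_second_order (jet_op q c f) x
      = (\<Sum>\<beta> | size \<beta> \<le> q. B \<beta> x * free_second_order (mpartial \<beta> f) x)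
        + ((\<Sum>\<beta> | size \<beta> \<le> q. free_second_order (B \<beta>) x * g \<beta>)
          - (\<Sum>\<beta> | size \<beta> \<le> q. \<Sum>a\<in>UNIV. partial a (B \<beta>) x * g (add_mset a \<beta>)))"
    unfolding jet_op second_order_multi_op[OF smooth_B f] g_def
    by (simp add: sum.distrib sum_subtractf)
  also have "\<dots> = jet_op q c (free_second_order f) x"
    unfolding difference jet_op using smooth_Hf by (simp add: multi_op_def mpartial_free_second_order f)
  finally show "free_second_order (jet_op q c f) x = jet_op q c (free_second_order f) x" .
qed

lemma symmetry_ops_free_dim_ge:
  fixes H :: "'n::finite operator"
  assumes H: "\<And>f. smooth f \<Longrightarrow> H f = free_second_order f"
  shows "N_tilde CARD('n) q \<le> real (op_space.dim (symmetry_ops q H))"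
proof -
  let ?I = "free_jets q :: ('n multiset \<times> 'n multiset) set"
  let ?S = "{c \<in> supported ?I. free_op c = 0}"
  have "free_op 0 = (0 :: 'n multiset \<times> 'n multiset \<Rightarrow> complex)"
    using free_op_scale[of 0 "0 :: 'n multiset \<times> 'n multiset \<Rightarrow> complex"]
    by (simp only: coeff_space.scale_zero_left coeff_space.scale_zero_right)
  then have S: "coeff_space.subspace ?S"
    using coeff_space.subspace_add[OF subspace_supported, of _ ?I]
      coeff_space.subspace_scale[OF subspace_supported, of _ ?I]
      coeff_space.subspace_0[OF subspace_supported, of ?I]
    by (intro coeff_space.subspaceI) (auto simp: free_op_add free_op_scale)
  have image: "jet_op q ` ?S \<subseteq> symmetry_ops q H"
  proof safe
    fix c assume c: "c \<in> supported ?I" "free_op c = 0"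
    have "H (jet_op q c f) = jet_op q c (H f)" if f: "smooth f" for f
    proof -
      have "smooth (jet_op q c f)"
        unfolding jet_op_def
        by (intro smooth_multi_op smooth_mult smooth_const smooth_jet_poly)
      then show ?thesis
        using jet_op_commutes[OF c f] by (simp add: H f)
    qed
    then show "jet_op q c \<in> symmetry_ops q H"
      by (simp add: symmetry_ops_def jet_op_diff_ops)
  qed
  obtain B where B: "finite B" "symmetry_ops q H \<subseteq> op_space.span B"
    using symmetry_ops_dim_le[of "\<lambda>_ _. 0" "\<lambda>_. 0" H q] H smooth_const by auto
  have ker: "{c \<in> ?S. jet_op q c = 0} \<subseteq> coeff_space.span {}"
    using jet_op_eq_zero by auto
  have "coeff_space.dim ?S = coeff_space.dim {c \<in> ?S. jet_op q c = 0} + op_space.dim (jet_op q ` ?S)"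
    by (rule coeff_op.rank_nullity_on(2)[OF S jet_op_linear ker _ order_trans[OF image B(2)] B(1)]) simp
  moreover have "coeff_space.dim {c \<in> ?S. jet_op q c = 0} = 0"
    using coeff_space.dim_le_card[OF ker] by simp
  moreover have "op_space.dim (jet_op q ` ?S) \<le> op_space.dim (symmetry_ops q H)"
    by (rule op_space.dim_mono_of_finite[OF image B(2,1)])
  ultimately show ?thesis
    using N_tilde_le_dim_free_jets[of q, where 'n = 'n] by linarith
qed

section \<open>The Hamiltonian as a second order operator\<close>

lemma smooth_potential:
  fixes A :: "real^'n::finite \<Rightarrow> real^'n"
  assumes "smooth A"
  shows "smooth (\<lambda>x. complex_of_real (e * A x $ a))"
  using assms
  by (intro smooth_bounded_linear[of "\<lambda>v. complex_of_real (e * v $ a)"])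
    (intro bounded_linear_compose[OF bounded_linear_of_real] bounded_linear_const_mult
      bounded_linear_vec_nth)

text \<open>Expanding the square, \<open>(p - e A)\<^sup>2 f = -\<Delta>f + 2 i e A\<cdot>\<nabla>f + (i e div A + e\<^sup>2 A\<^sup>2) f\<close>.\<close>

lemma hamiltonian_eq_second_order:
  fixes A :: "real^'n::finite \<Rightarrow> real^'n"
  assumes A: "smooth A" and f: "smooth f"
  shows "hamiltonian e A V f = second_order (\<lambda>a x. \<i> * of_real (e * A x $ a))
    (\<lambda>x. 1 / 2 * ((\<Sum>a\<in>UNIV. \<i> * partial a (\<lambda>x. of_real (e * A x $ a)) x + (of_real (e * A x $ a))\<^sup>2)
      + of_real (V x))) f"
proof
  fix x
  define A' where "A' a = (\<lambda>x. complex_of_real (e * A x $ a))" for a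
  have smooth_A': "smooth (A' a)" for a
    unfolding A'_def by (rule smooth_potential[OF A])
  have kinetic: "kinetic_momentum e A a g = (\<lambda>x. (- \<i>) * partial a g x + (- 1) * (A' a x * g x))" for a g
    by (auto simp: kinetic_momentum_def momentum_def A'_def)
  have partial_kinetic: "partial a (kinetic_momentum e A a f) x
      = - \<i> * partial a (partial a f) x - (partial a (A' a) x * f x + A' a x * partial a f x)" for a
  proof -
    have "partials [a] (kinetic_momentum e A a f)
        = (\<lambda>x. partials [a] (\<lambda>x. (- \<i>) * partial a f x) x + partials [a] (\<lambda>x. (- 1) * (A' a x * f x)) x)"
      unfolding kinetic by (rule partials_add) (intro smooth_mult smooth_const smooth_partial f smooth_A')+
    then have "partial a (kinetic_momentum e A a f) x
        = partials [a] (\<lambda>x. (- \<i>) * partial a f x) x + partials [a] (\<lambda>x. (- 1) * (A' a x * f x)) x"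
      by (simp only: partials_Cons partials_Nil)
    also have "\<dots> = (- \<i>) * partial a (partial a f) x + (- 1) * partial a (\<lambda>x. A' a x * f x) x"
      by (subst (1 2) partials_cmult) (auto intro!: smooth_partial smooth_mult f smooth_A')
    finally show ?thesis
      by (simp add: partial_mult smooth_differentiable f smooth_A')
  qed
  have "kinetic_momentum e A a (kinetic_momentum e A a f) x
      = - partial a (partial a f) x + 2 * (\<i> * A' a x * partial a f x)
        + (\<i> * partial a (A' a) x + (A' a x)\<^sup>2) * f x" for a
  proof -
    have "kinetic_momentum e A a (kinetic_momentum e A a f) x
        = (- \<i>) * partial a (kinetic_momentum e A a f) x + (- 1) * (A' a x * kinetic_momentum e A a f x)"
      by (rule fun_cong[OF kinetic])
    also have "kinetic_momentum e A a f x = (- \<i>) * partial a f x + (- 1) * (A' a x * f x)"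
      by (rule fun_cong[OF kinetic])
    finally show ?thesis
      unfolding partial_kinetic by (simp add: algebra_simps power2_eq_square)
  qed
  then have op: "op_square (kinetic_momentum e A) f x = (\<Sum>a\<in>UNIV. - partial a (partial a f) x
      + 2 * (\<i> * A' a x * partial a f x) + (\<i> * partial a (A' a) x + (A' a x)\<^sup>2) * f x)"
    by (simp only: op_square_def)
  define S where "S = (\<Sum>a\<in>UNIV. partial a (partial a f) x)"
  define U where "U = (\<Sum>a\<in>UNIV. \<i> * A' a x * partial a f x)"
  define W where "W = (\<Sum>a\<in>UNIV. \<i> * partial a (A' a) x + (A' a x)\<^sup>2)"
  have "op_square (kinetic_momentum e A) f x = - S + 2 * U + W * f x"
    unfolding op S_def U_def W_def sum_distrib_left sum_distrib_right sum_negf[symmetric]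
      sum.distrib[symmetric] ..
  then have "hamiltonian e A V f x = - (1 / 2) * S + U + 1 / 2 * (W + of_real (V x)) * f x"
    unfolding hamiltonian_def by (simp only:) (simp add: field_simps)
  then show "hamiltonian e A V f x = second_order (\<lambda>a x. \<i> * of_real (e * A x $ a))
    (\<lambda>x. 1 / 2 * ((\<Sum>a\<in>UNIV. \<i> * partial a (\<lambda>x. of_real (e * A x $ a)) x + (of_real (e * A x $ a))\<^sup>2)
      + of_real (V x))) f x"
    by (simp only: second_order_def S_def U_def W_def A'_def)
qed

theorem theorem2:
  fixes A :: "real^'n::finite \<Rightarrow> real^'n"
    and V :: "real^'n \<Rightarrow> real"
    and e :: real
    and q :: nat
  assumes "CARD('n) \<in> {1, 2, 3, 4}"
    and "smooth A"
    and "smooth V"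
  shows "finite_dim_ops (symmetry_ops q (hamiltonian e A V)) \<and>
    real (op_space.dim (symmetry_ops q (hamiltonian e A V))) \<le> N_tilde CARD('n) q \<and>
    finite_dim_ops (symmetry_ops q (hamiltonian e (\<lambda>_. 0) (\<lambda>_. 0) :: 'n operator)) \<and>
    real (op_space.dim (symmetry_ops q (hamiltonian e (\<lambda>_. 0) (\<lambda>_. 0) :: 'n operator)))
      = N_tilde CARD('n) q"
proof -
  define u where "u = (\<lambda>a x. \<i> * complex_of_real (e * A x $ a))"
  define w where "w = (\<lambda>x. 1 / 2 * ((\<Sum>a\<in>UNIV. \<i> * partial a (\<lambda>x. complex_of_real (e * A x $ a)) x
      + (of_real (e * A x $ a))\<^sup>2) + of_real (V x)))"
  have H: "hamiltonian e A V f = second_order u w f" if "smooth f" for f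
    using hamiltonian_eq_second_order[OF assms(2) that] by (simp only: u_def w_def)
  have u: "smooth (u a)" for a
    unfolding u_def by (intro smooth_mult smooth_const smooth_potential assms)
  have w: "smooth w"
    unfolding w_def power2_eq_square
    by (intro smooth_intros smooth_potential assms smooth_bounded_linear[OF bounded_linear_of_real])
  have free: "hamiltonian e (\<lambda>_. 0) (\<lambda>_. 0) f = free_second_order f" if "smooth f" for f :: "real^'n \<Rightarrow> complex"
    using hamiltonian_eq_second_order[OF smooth_const that, of e 0 "\<lambda>_. 0"]
    by simp
  have "op_space.dim (symmetry_ops q (hamiltonian e (\<lambda>_. 0) (\<lambda>_. 0) :: 'n operator)) \<le> N_tilde CARD('n) q
      \<and> finite_dim_ops (symmetry_ops q (hamiltonian e (\<lambda>_. 0) (\<lambda>_. 0) :: 'n operator))"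
    using symmetry_ops_dim_le[OF _ _ free, of q] smooth_const by (auto simp: finite_dim_ops_def)
  then show ?thesis
    using symmetry_ops_dim_le[OF u w H, of q] symmetry_ops_free_dim_ge[OF free, of q]
    by (auto simp: finite_dim_ops_def)
qed

end
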